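(* Each Gr-category is Gr-equivalent to a strict Gr-category.
   Context: A Gr-category is a monoidal category $(\mathcal C,\otimes,I,a,l,r)$ in which every object is invertible (for $\otimes$, up to isomorphism) and every arrow is an isomorphism. It is strict if the associativity constraint $a$ and the unit constraints $l,r$ are all identities. A Gr-functor is a monoidal functor $(F,\widetilde F,\hat F)$ between Gr-categories (with $\widetilde F$ and $\hat F$ isomorphisms). Two Gr-categories $\mathcal C,\mathcal C'$ are Gr-equivalent if they are monoidally equivalent, i.e. there are monoidal functors $F:\mathcal C\to\mathcal C'$ and $G:\mathcal C'\to\mathcal C$ together with natural monoidal isomorphisms $GF\cong \mathrm{id}_{\mathcal C}$ and $FG\cong\mathrm{id}_{\mathcal C'}$. *)

theory Defs
  imports Main
begin

record ('o, 'a) category =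
  Obj :: "'o set"
  Arr :: "'a set"
  Dom :: "'a \<Rightarrow> 'o"
  Cod :: "'a \<Rightarrow> 'o"
  Ident :: "'o \<Rightarrow> 'a"
  Comp :: "'a \<Rightarrow> 'a \<Rightarrow> 'a" (infixr "\<cdot>\<index>" 65)

definition Hom :: "('o, 'a, 'm) category_scheme \<Rightarrow> 'o \<Rightarrow> 'o \<Rightarrow> 'a set" where
  "Hom C X Y = {f \<in> Arr C. Dom C f = X \<and> Cod C f = Y}"

locale category =
  fixes C :: "('o, 'a, 'm) category_scheme" (structure)
  assumes dom_obj: "f \<in> Arr C \<Longrightarrow> Dom C f \<in> Obj C"
    and cod_obj: "f \<in> Arr C \<Longrightarrow> Cod C f \<in> Obj C"
    and ident_hom: "X \<in> Obj C \<Longrightarrow> Ident C X \<in> Hom C X X"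
    and comp_hom: "\<lbrakk>f \<in> Hom C X Y; g \<in> Hom C Y Z\<rbrakk> \<Longrightarrow> g \<cdot> f \<in> Hom C X Z"
    and comp_ident_left: "f \<in> Hom C X Y \<Longrightarrow> Ident C Y \<cdot> f = f"
    and comp_ident_right: "f \<in> Hom C X Y \<Longrightarrow> f \<cdot> Ident C X = f"
    and comp_assoc: "\<lbrakk>f \<in> Hom C X Y; g \<in> Hom C Y Z; h \<in> Hom C Z W\<rbrakk> \<Longrightarrow> (h \<cdot> g) \<cdot> f = h \<cdot> (g \<cdot> f)"

definition is_iso :: "('o, 'a, 'm) category_scheme \<Rightarrow> 'a \<Rightarrow> bool" where
  "is_iso C f \<longleftrightarrow> f \<in> Arr C \<and>
     (\<exists>g \<in> Hom C (Cod C f) (Dom C f).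
        g \<cdot>\<^bsub>C\<^esub> f = Ident C (Dom C f) \<and> f \<cdot>\<^bsub>C\<^esub> g = Ident C (Cod C f))"

definition isomorphic :: "('o, 'a, 'm) category_scheme \<Rightarrow> 'o \<Rightarrow> 'o \<Rightarrow> bool" (infix "\<cong>\<index>" 50) where
  "X \<cong>\<^bsub>C\<^esub> Y \<longleftrightarrow> (\<exists>f \<in> Hom C X Y. is_iso C f)"

record ('o, 'a) monoidal_category = "('o, 'a) category" +
  TensorObj :: "'o \<Rightarrow> 'o \<Rightarrow> 'o" (infixr "\<otimes>\<index>" 70)
  TensorArr :: "'a \<Rightarrow> 'a \<Rightarrow> 'a" (infixr "\<otimes>\<^sub>a\<index>" 70)
  UnitObj :: "'o" ("\<I>\<index>")
  Assoc :: "'o \<Rightarrow> 'o \<Rightarrow> 'o \<Rightarrow> 'a" ("\<a>\<index>")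
  LUnit :: "'o \<Rightarrow> 'a" ("\<l>\<index>")
  RUnit :: "'o \<Rightarrow> 'a" ("\<r>\<index>")

locale monoidal_category = category C
  for C :: "('o, 'a, 'm) monoidal_category_scheme" (structure) +
  assumes tensor_obj: "\<lbrakk>X \<in> Obj C; Y \<in> Obj C\<rbrakk> \<Longrightarrow> X \<otimes> Y \<in> Obj C"
    and tensor_hom:
      "\<lbrakk>f \<in> Hom C X X'; g \<in> Hom C Y Y'\<rbrakk> \<Longrightarrow> f \<otimes>\<^sub>a g \<in> Hom C (X \<otimes> Y) (X' \<otimes> Y')"
    and tensor_ident: "\<lbrakk>X \<in> Obj C; Y \<in> Obj C\<rbrakk> \<Longrightarrow> Ident C X \<otimes>\<^sub>a Ident C Y = Ident C (X \<otimes> Y)"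
    and tensor_comp:
      "\<lbrakk>f \<in> Hom C X X'; f' \<in> Hom C X' X''; g \<in> Hom C Y Y'; g' \<in> Hom C Y' Y''\<rbrakk>
        \<Longrightarrow> (f' \<cdot> f) \<otimes>\<^sub>a (g' \<cdot> g) = (f' \<otimes>\<^sub>a g') \<cdot> (f \<otimes>\<^sub>a g)"
    and unit_obj: "\<I> \<in> Obj C"
    and assoc_hom:
      "\<lbrakk>X \<in> Obj C; Y \<in> Obj C; Z \<in> Obj C\<rbrakk> \<Longrightarrow> \<a> X Y Z \<in> Hom C ((X \<otimes> Y) \<otimes> Z) (X \<otimes> (Y \<otimes> Z))"
    and assoc_iso: "\<lbrakk>X \<in> Obj C; Y \<in> Obj C; Z \<in> Obj C\<rbrakk> \<Longrightarrow> is_iso C (\<a> X Y Z)"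
    and assoc_natural:
      "\<lbrakk>f \<in> Hom C X X'; g \<in> Hom C Y Y'; h \<in> Hom C Z Z'\<rbrakk>
        \<Longrightarrow> \<a> X' Y' Z' \<cdot> ((f \<otimes>\<^sub>a g) \<otimes>\<^sub>a h) = (f \<otimes>\<^sub>a (g \<otimes>\<^sub>a h)) \<cdot> \<a> X Y Z"
    and lunit_hom: "X \<in> Obj C \<Longrightarrow> \<l> X \<in> Hom C (\<I> \<otimes> X) X"
    and lunit_iso: "X \<in> Obj C \<Longrightarrow> is_iso C (\<l> X)"
    and lunit_natural: "f \<in> Hom C X Y \<Longrightarrow> \<l> Y \<cdot> (Ident C \<I> \<otimes>\<^sub>a f) = f \<cdot> \<l> X"
    and runit_hom: "X \<in> Obj C \<Longrightarrow> \<r> X \<in> Hom C (X \<otimes> \<I>) X"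
    and runit_iso: "X \<in> Obj C \<Longrightarrow> is_iso C (\<r> X)"
    and runit_natural: "f \<in> Hom C X Y \<Longrightarrow> \<r> Y \<cdot> (f \<otimes>\<^sub>a Ident C \<I>) = f \<cdot> \<r> X"
    and pentagon:
      "\<lbrakk>X \<in> Obj C; Y \<in> Obj C; Z \<in> Obj C; W \<in> Obj C\<rbrakk>
        \<Longrightarrow> (Ident C X \<otimes>\<^sub>a \<a> Y Z W) \<cdot> \<a> X (Y \<otimes> Z) W \<cdot> (\<a> X Y Z \<otimes>\<^sub>a Ident C W)
           = \<a> X Y (Z \<otimes> W) \<cdot> \<a> (X \<otimes> Y) Z W"
    and triangle:
      "\<lbrakk>X \<in> Obj C; Y \<in> Obj C\<rbrakk> \<Longrightarrow> (Ident C X \<otimes>\<^sub>a \<l> Y) \<cdot> \<a> X \<I> Y = \<r> X \<otimes>\<^sub>a Ident C Y"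

locale gr_category = monoidal_category C
  for C :: "('o, 'a, 'm) monoidal_category_scheme" (structure) +
  assumes obj_invertible: "X \<in> Obj C \<Longrightarrow> \<exists>Y \<in> Obj C. X \<otimes> Y \<cong> \<I> \<and> Y \<otimes> X \<cong> \<I>"
    and arr_iso: "f \<in> Arr C \<Longrightarrow> is_iso C f"

text \<open>Since the typing of \<open>\<a>\<close>, \<open>\<l>\<close>, \<open>\<r>\<close> is part of \<^locale>\<open>monoidal_category\<close>, comparing
  the codomains of both sides below yields \<open>(X \<otimes> Y) \<otimes> Z = X \<otimes> (Y \<otimes> Z)\<close>,
  \<open>\<I> \<otimes> X = X\<close> and \<open>X \<otimes> \<I> = X\<close> on objects.\<close>

locale strict_gr_category = gr_category C
  for C :: "('o, 'a, 'm) monoidal_category_scheme" (structure) +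
  assumes assoc_strict:
      "\<lbrakk>X \<in> Obj C; Y \<in> Obj C; Z \<in> Obj C\<rbrakk> \<Longrightarrow> \<a> X Y Z = Ident C ((X \<otimes> Y) \<otimes> Z)"
    and lunit_strict: "X \<in> Obj C \<Longrightarrow> \<l> X = Ident C (\<I> \<otimes> X)"
    and runit_strict: "X \<in> Obj C \<Longrightarrow> \<r> X = Ident C (X \<otimes> \<I>)"

text \<open>For a monoidal functor \<open>F\<close> from \<open>C\<close> to \<open>D\<close>, the structure isomorphisms are
  directed as \<open>FTensor F X Y : F X \<otimes> F Y \<rightarrow> F (X \<otimes> Y)\<close> and \<open>FUnit F : \<I> \<rightarrow> F \<I>\<close>.\<close>

record ('o, 'a, 'p, 'b) monoidal_functor =
  FObj :: "'o \<Rightarrow> 'p"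
  FArr :: "'a \<Rightarrow> 'b"
  FTensor :: "'o \<Rightarrow> 'o \<Rightarrow> 'b"
  FUnit :: "'b"

locale monoidal_functor =
  C: monoidal_category C + D: monoidal_category D
  for C :: "('o, 'a, 'm) monoidal_category_scheme"
    and D :: "('p, 'b, 'n) monoidal_category_scheme" +
  fixes F :: "('o, 'a, 'p, 'b) monoidal_functor"
  assumes fobj: "X \<in> Obj C \<Longrightarrow> FObj F X \<in> Obj D"
    and farr_hom: "f \<in> Hom C X Y \<Longrightarrow> FArr F f \<in> Hom D (FObj F X) (FObj F Y)"
    and farr_ident: "X \<in> Obj C \<Longrightarrow> FArr F (Ident C X) = Ident D (FObj F X)"
    and farr_comp:
      "\<lbrakk>f \<in> Hom C X Y; g \<in> Hom C Y Z\<rbrakk> \<Longrightarrow> FArr F (g \<cdot>\<^bsub>C\<^esub> f) = FArr F g \<cdot>\<^bsub>D\<^esub> FArr F f"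
    and ftensor_hom:
      "\<lbrakk>X \<in> Obj C; Y \<in> Obj C\<rbrakk>
        \<Longrightarrow> FTensor F X Y \<in> Hom D (FObj F X \<otimes>\<^bsub>D\<^esub> FObj F Y) (FObj F (X \<otimes>\<^bsub>C\<^esub> Y))"
    and ftensor_iso: "\<lbrakk>X \<in> Obj C; Y \<in> Obj C\<rbrakk> \<Longrightarrow> is_iso D (FTensor F X Y)"
    and ftensor_natural:
      "\<lbrakk>f \<in> Hom C X X'; g \<in> Hom C Y Y'\<rbrakk>
        \<Longrightarrow> FTensor F X' Y' \<cdot>\<^bsub>D\<^esub> (FArr F f \<otimes>\<^sub>a\<^bsub>D\<^esub> FArr F g) = FArr F (f \<otimes>\<^sub>a\<^bsub>C\<^esub> g) \<cdot>\<^bsub>D\<^esub> FTensor F X Y"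
    and funit_hom: "FUnit F \<in> Hom D \<I>\<^bsub>D\<^esub> (FObj F \<I>\<^bsub>C\<^esub>)"
    and funit_iso: "is_iso D (FUnit F)"
    and fassoc:
      "\<lbrakk>X \<in> Obj C; Y \<in> Obj C; Z \<in> Obj C\<rbrakk>
        \<Longrightarrow> FArr F (\<a>\<^bsub>C\<^esub> X Y Z) \<cdot>\<^bsub>D\<^esub> FTensor F (X \<otimes>\<^bsub>C\<^esub> Y) Z \<cdot>\<^bsub>D\<^esub> (FTensor F X Y \<otimes>\<^sub>a\<^bsub>D\<^esub> Ident D (FObj F Z))
           = FTensor F X (Y \<otimes>\<^bsub>C\<^esub> Z) \<cdot>\<^bsub>D\<^esub> (Ident D (FObj F X) \<otimes>\<^sub>a\<^bsub>D\<^esub> FTensor F Y Z)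
               \<cdot>\<^bsub>D\<^esub> \<a>\<^bsub>D\<^esub> (FObj F X) (FObj F Y) (FObj F Z)"
    and flunit:
      "X \<in> Obj C
        \<Longrightarrow> FArr F (\<l>\<^bsub>C\<^esub> X) \<cdot>\<^bsub>D\<^esub> FTensor F \<I>\<^bsub>C\<^esub> X \<cdot>\<^bsub>D\<^esub> (FUnit F \<otimes>\<^sub>a\<^bsub>D\<^esub> Ident D (FObj F X))
           = \<l>\<^bsub>D\<^esub> (FObj F X)"
    and frunit:
      "X \<in> Obj C
        \<Longrightarrow> FArr F (\<r>\<^bsub>C\<^esub> X) \<cdot>\<^bsub>D\<^esub> FTensor F X \<I>\<^bsub>C\<^esub> \<cdot>\<^bsub>D\<^esub> (Ident D (FObj F X) \<otimes>\<^sub>a\<^bsub>D\<^esub> FUnit F)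
           = \<r>\<^bsub>D\<^esub> (FObj F X)"

definition id_functor ::
  "('o, 'a, 'm) monoidal_category_scheme \<Rightarrow> ('o, 'a, 'o, 'a) monoidal_functor" where
  "id_functor C =
     \<lparr>FObj = (\<lambda>X. X), FArr = (\<lambda>f. f),
      FTensor = (\<lambda>X Y. Ident C (X \<otimes>\<^bsub>C\<^esub> Y)), FUnit = Ident C \<I>\<^bsub>C\<^esub>\<rparr>"

text \<open>\<open>comp_functor E G F\<close> is the composite \<open>G F\<close>; the category \<open>E\<close> is the codomain of \<open>G\<close>.\<close>

definition comp_functor ::
  "('q, 'c, 'k) monoidal_category_scheme \<Rightarrow> ('p, 'b, 'q, 'c) monoidal_functor
    \<Rightarrow> ('o, 'a, 'p, 'b) monoidal_functor \<Rightarrow> ('o, 'a, 'q, 'c) monoidal_functor" where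
  "comp_functor E G F =
     \<lparr>FObj = (\<lambda>X. FObj G (FObj F X)), FArr = (\<lambda>f. FArr G (FArr F f)),
      FTensor = (\<lambda>X Y. FArr G (FTensor F X Y) \<cdot>\<^bsub>E\<^esub> FTensor G (FObj F X) (FObj F Y)),
      FUnit = FArr G (FUnit F) \<cdot>\<^bsub>E\<^esub> FUnit G\<rparr>"

locale monoidal_nat_iso =
  F: monoidal_functor C D F + G: monoidal_functor C D G
  for C :: "('o, 'a, 'm) monoidal_category_scheme"
    and D :: "('p, 'b, 'n) monoidal_category_scheme"
    and F G :: "('o, 'a, 'p, 'b) monoidal_functor" +
  fixes \<alpha> :: "'o \<Rightarrow> 'b"
  assumes component_hom: "X \<in> Obj C \<Longrightarrow> \<alpha> X \<in> Hom D (FObj F X) (FObj G X)"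
    and component_iso: "X \<in> Obj C \<Longrightarrow> is_iso D (\<alpha> X)"
    and natural: "f \<in> Hom C X Y \<Longrightarrow> \<alpha> Y \<cdot>\<^bsub>D\<^esub> FArr F f = FArr G f \<cdot>\<^bsub>D\<^esub> \<alpha> X"
    and monoidal_tensor:
      "\<lbrakk>X \<in> Obj C; Y \<in> Obj C\<rbrakk>
        \<Longrightarrow> \<alpha> (X \<otimes>\<^bsub>C\<^esub> Y) \<cdot>\<^bsub>D\<^esub> FTensor F X Y = FTensor G X Y \<cdot>\<^bsub>D\<^esub> (\<alpha> X \<otimes>\<^sub>a\<^bsub>D\<^esub> \<alpha> Y)"
    and monoidal_unit: "\<alpha> \<I>\<^bsub>C\<^esub> \<cdot>\<^bsub>D\<^esub> FUnit F = FUnit G"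

definition monoidally_equivalent ::
  "('o, 'a, 'm) monoidal_category_scheme \<Rightarrow> ('p, 'b, 'n) monoidal_category_scheme \<Rightarrow> bool" where
  "monoidally_equivalent C D \<longleftrightarrow>
     (\<exists>F G \<alpha> \<beta>. monoidal_functor C D F \<and> monoidal_functor D C G \<and>
        monoidal_nat_iso C C (comp_functor C G F) (id_functor C) \<alpha> \<and>
        monoidal_nat_iso D D (comp_functor D F G) (id_functor D) \<beta>)"

definition gr_equivalent ::
  "('o, 'a, 'm) monoidal_category_scheme \<Rightarrow> ('p, 'b, 'n) monoidal_category_scheme \<Rightarrow> bool" where
  "gr_equivalent C D \<longleftrightarrow> gr_category C \<and> gr_category D \<and> monoidally_equivalent C D"

end

theory Submission imports Defs begin

text \<open>
  The strict model has the finite lists of objects of \<open>C\<close> as its objects, with concatenation as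
  tensor product and the empty list as unit. A list stands for the right-nested tensor product
  \<open>X\<^sub>1 \<otimes> (X\<^sub>2 \<otimes> (\<dots> \<otimes> \<I>))\<close> of its entries, and an arrow from one list to another is simply an
  arrow of \<open>C\<close> between the products that they stand for. Concatenation is associative and unital
  on the nose, so the constraints of the model can be taken to be identities; all the mathematics
  is in showing that this is legitimate.

  The tensor product of two arrows of the model must go from a product over \<open>Xs @ Xs'\<close> to a
  product over \<open>Ys @ Ys'\<close>, so it is the tensor product in \<open>C\<close> conjugated by the canonical
  isomorphisms \<open>glue Xs Ys\<close> that rebracket two right-nested products into one. Strict associativity
  of this operation on arrows, and hence naturality of the identity associator, amounts to
  \<open>glue_assoc\<close>: the two ways of rebracketing three blocks agree. The inductive step of that lemma
  is the pentagon. Its base case, and the corresponding statement for the unit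
  (\<open>glue_Nil_right\<close>), rest on the three classical coherences for the unit
  constraints that follow from the pentagon and the triangle: \<open>lunit_tensor\<close>, \<open>runit_tensor\<close> and
  \<open>lunit_unit_eq_runit_unit\<close>.

  Sending a list to its product is a monoidal functor to \<open>C\<close>, with structure isomorphisms \<open>glue\<close>.
  It is bijective on hom-sets by construction, and every object \<open>X\<close> is isomorphic to the product
  \<open>X \<otimes> \<I>\<close> of the list \<open>[X]\<close>. A monoidal functor that is fully faithful and essentially surjective
  is a monoidal equivalence: a quasi-inverse is obtained by choosing objects and lifting arrows,
  and each of its axioms may be tested after applying the functor, where it
  becomes a naturality statement (\<open>monoidal_weak_equivalence.monoidally_equivalent\<close>). Finally,
  inverses of objects and of arrows in \<open>C\<close> can be lifted along this functor, so the strict model of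
  a Gr-category is again a Gr-category.
\<close>

section \<open>Composition and inverses in a category\<close>

text \<open>
  The axioms are recast with \<open>Arr\<close>, \<open>Dom\<close> and \<open>Cod\<close> in place of \<open>Hom\<close>. The premises then mention no
  objects beyond those in the conclusion, so that the simplifier can typecheck composites by
  itself, reassociate them to the right and cancel inverses.
\<close>

lemma in_Hom_iff: "f \<in> Hom C X Y \<longleftrightarrow> f \<in> Arr C \<and> Dom C f = X \<and> Cod C f = Y"
  by (auto simp: Hom_def)

definition inv_arr :: "('o, 'a, 'm) category_scheme \<Rightarrow> 'a \<Rightarrow> 'a" ("inv\<index> _" [81] 80) where
  "inv\<^bsub>C\<^esub> f = (SOME g. g \<in> Hom C (Cod C f) (Dom C f) \<and>
     g \<cdot>\<^bsub>C\<^esub> f = Ident C (Dom C f) \<and> f \<cdot>\<^bsub>C\<^esub> g = Ident C (Cod C f))"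

context category
begin

lemma dom_cod_obj [simp]: "f \<in> Arr C \<Longrightarrow> Dom C f \<in> Obj C" "f \<in> Arr C \<Longrightarrow> Cod C f \<in> Obj C"
  using dom_obj cod_obj by auto

lemma ident_arr [simp]:
  assumes "X \<in> Obj C"
  shows "Ident C X \<in> Arr C" "Dom C (Ident C X) = X" "Cod C (Ident C X) = X"
  using ident_hom[OF assms] by (auto simp: in_Hom_iff)

lemma comp_arr [simp]:
  assumes "f \<in> Arr C" "g \<in> Arr C" "Cod C f = Dom C g"
  shows "g \<cdot> f \<in> Arr C" "Dom C (g \<cdot> f) = Dom C f" "Cod C (g \<cdot> f) = Cod C g"
  using comp_hom[of f "Dom C f" "Cod C f" g "Cod C g"] assms by (auto simp: in_Hom_iff)

lemma ident_comp [simp]: "f \<in> Arr C \<Longrightarrow> Cod C f = Y \<Longrightarrow> Ident C Y \<cdot> f = f"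
  using comp_ident_left by (auto simp: in_Hom_iff)

lemma comp_ident [simp]: "f \<in> Arr C \<Longrightarrow> Dom C f = X \<Longrightarrow> f \<cdot> Ident C X = f"
  using comp_ident_right by (auto simp: in_Hom_iff)

lemma comp_reassoc [simp]:
  "f \<in> Arr C \<Longrightarrow> g \<in> Arr C \<Longrightarrow> h \<in> Arr C \<Longrightarrow> Cod C f = Dom C g \<Longrightarrow> Cod C g = Dom C h
    \<Longrightarrow> (h \<cdot> g) \<cdot> f = h \<cdot> (g \<cdot> f)"
  using comp_assoc by (auto simp: in_Hom_iff)

lemma iso_arr: "is_iso C f \<Longrightarrow> f \<in> Arr C"
  by (simp add: is_iso_def)

lemma inv_arr_hom:
  assumes "is_iso C f"
  shows "inv f \<in> Hom C (Cod C f) (Dom C f)" (is ?A)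
    and "inv f \<cdot> f = Ident C (Dom C f)" (is ?B)
    and "f \<cdot> inv f = Ident C (Cod C f)" (is ?D)
proof -
  have "?A \<and> ?B \<and> ?D"
    unfolding inv_arr_def by (rule someI_ex) (use assms in \<open>auto simp: is_iso_def\<close>)
  then show ?A ?B ?D by auto
qed

lemma inv_arr_simps [simp]:
  assumes "is_iso C f"
  shows "inv f \<in> Arr C" "Dom C (inv f) = Cod C f" "Cod C (inv f) = Dom C f"
  using inv_arr_hom(1)[OF assms] by (auto simp: in_Hom_iff)

lemmas inv_comp [simp] = inv_arr_hom(2,3)

lemma inv_comp_comp [simp]:
  assumes iso: "is_iso C f" and "g \<in> Arr C"
  shows "Cod C g = Dom C f \<Longrightarrow> inv f \<cdot> (f \<cdot> g) = g"
    and "Cod C g = Cod C f \<Longrightarrow> f \<cdot> (inv f \<cdot> g) = g"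
proof -
  note [simp] = iso_arr[OF iso] inv_arr_simps[OF iso] inv_comp[OF iso]
  show "inv f \<cdot> (f \<cdot> g) = g" if "Cod C g = Dom C f"
    using comp_reassoc[of g f "inv f"] assms(2) that by (simp del: comp_reassoc)
  show "f \<cdot> (inv f \<cdot> g) = g" if "Cod C g = Cod C f"
    using comp_reassoc[of g "inv f" f] assms(2) that by (simp del: comp_reassoc)
qed

lemma isoI:
  assumes "f \<in> Arr C" "g \<in> Arr C" "Dom C g = Cod C f" "Cod C g = Dom C f"
    "g \<cdot> f = Ident C (Dom C f)" "f \<cdot> g = Ident C (Cod C f)"
  shows "is_iso C f"
  using assms by (auto simp: is_iso_def in_Hom_iff)

lemma inv_iso [simp]: "is_iso C f \<Longrightarrow> is_iso C (inv f)"
  by (rule isoI[of _ f]) (simp_all add: iso_arr)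

lemma comp_iso:
  assumes "is_iso C f" "is_iso C g" "Cod C f = Dom C g"
  shows "is_iso C (g \<cdot> f)"
  by (rule isoI[of _ "inv f \<cdot> inv g"]) (use assms in \<open>simp_all add: iso_arr\<close>)

lemma ident_iso [simp]: "X \<in> Obj C \<Longrightarrow> is_iso C (Ident C X)"
  by (rule isoI[of _ "Ident C X"]) simp_all

lemma iso_cancel_left:
  assumes "is_iso C h" "f \<in> Arr C" "g \<in> Arr C" "Cod C f = Dom C h" "Cod C g = Dom C h"
    and "h \<cdot> f = h \<cdot> g"
  shows "f = g"
proof -
  have "f = inv h \<cdot> (h \<cdot> f)"
    using assms(1,2,4) by simp
  also have "\<dots> = inv h \<cdot> (h \<cdot> g)"
    by (simp only: assms(6))
  also have "\<dots> = g"
    using assms(1,3,5) by simp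
  finally show ?thesis .
qed

lemma iso_cancel_right:
  assumes "is_iso C h" "f \<in> Arr C" "g \<in> Arr C" "Dom C f = Cod C h" "Dom C g = Cod C h"
    and "f \<cdot> h = g \<cdot> h"
  shows "f = g"
proof -
  have "f = (f \<cdot> h) \<cdot> inv h"
    using assms(1,2,4) by (simp add: iso_arr)
  also have "\<dots> = (g \<cdot> h) \<cdot> inv h"
    by (simp only: assms(6))
  also have "\<dots> = g"
    using assms(1,3,5) by (simp add: iso_arr)
  finally show ?thesis .
qed

end

section \<open>Tensor products of arrows\<close>

context monoidal_category
begin

declare unit_obj [simp] tensor_obj [simp] tensor_ident [simp]

lemma tensor_arr [simp]:
  assumes "f \<in> Arr C" "g \<in> Arr C"
  shows "f \<otimes>\<^sub>a g \<in> Arr C" "Dom C (f \<otimes>\<^sub>a g) = Dom C f \<otimes> Dom C g"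
    "Cod C (f \<otimes>\<^sub>a g) = Cod C f \<otimes> Cod C g"
  using tensor_hom[of f "Dom C f" "Cod C f" g "Dom C g" "Cod C g"] assms
  by (auto simp: in_Hom_iff)

text \<open>
  Adjacent tensor products of arrows are merged into one. A proof that needs the opposite direction,
  as every use of naturality does, states the split composite and lets both sides merge.
\<close>

lemma interchange [simp]:
  assumes "f \<in> Arr C" "f' \<in> Arr C" "g \<in> Arr C" "g' \<in> Arr C"
    "Cod C f = Dom C f'" "Cod C g = Dom C g'"
  shows "(f' \<otimes>\<^sub>a g') \<cdot> (f \<otimes>\<^sub>a g) = (f' \<cdot> f) \<otimes>\<^sub>a (g' \<cdot> g)"
  using tensor_comp[of f "Dom C f" "Cod C f" f' "Cod C f'" g "Dom C g" "Cod C g" g' "Cod C g'"]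
    assms by (simp add: in_Hom_iff)

text \<open>The same law at the head of a longer composite that has been reassociated to the right.\<close>

lemma interchange_comp [simp]:
  assumes "f \<in> Arr C" "f' \<in> Arr C" "g \<in> Arr C" "g' \<in> Arr C"
    "Cod C f = Dom C f'" "Cod C g = Dom C g'" "h \<in> Arr C" "Cod C h = Dom C f \<otimes> Dom C g"
  shows "(f' \<otimes>\<^sub>a g') \<cdot> ((f \<otimes>\<^sub>a g) \<cdot> h) = ((f' \<cdot> f) \<otimes>\<^sub>a (g' \<cdot> g)) \<cdot> h"
  using comp_reassoc[of h "f \<otimes>\<^sub>a g" "f' \<otimes>\<^sub>a g'"] assms by simp

lemma tensor_iso [simp]:
  assumes "is_iso C f" "is_iso C g"
  shows "is_iso C (f \<otimes>\<^sub>a g)"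
  by (rule isoI[of _ "inv f \<otimes>\<^sub>a inv g"]) (use assms in \<open>simp_all add: iso_arr\<close>)

lemma assoc_arr [simp]:
  assumes "X \<in> Obj C" "Y \<in> Obj C" "Z \<in> Obj C"
  shows "\<a> X Y Z \<in> Arr C" "Dom C (\<a> X Y Z) = (X \<otimes> Y) \<otimes> Z"
    "Cod C (\<a> X Y Z) = X \<otimes> (Y \<otimes> Z)" "is_iso C (\<a> X Y Z)"
  using assoc_hom[OF assms] assoc_iso[OF assms] by (auto simp: in_Hom_iff)

lemma unitor_arr [simp]:
  assumes "X \<in> Obj C"
  shows "\<l> X \<in> Arr C" "Dom C (\<l> X) = \<I> \<otimes> X" "Cod C (\<l> X) = X" "is_iso C (\<l> X)"
    "\<r> X \<in> Arr C" "Dom C (\<r> X) = X \<otimes> \<I>" "Cod C (\<r> X) = X" "is_iso C (\<r> X)"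
  using lunit_hom[OF assms] lunit_iso[OF assms] runit_hom[OF assms] runit_iso[OF assms]
  by (auto simp: in_Hom_iff)

lemma assoc_natural_arr:
  assumes "f \<in> Arr C" "g \<in> Arr C" "h \<in> Arr C" "Cod C f = X" "Cod C g = Y" "Cod C h = Z"
  shows "\<a> X Y Z \<cdot> ((f \<otimes>\<^sub>a g) \<otimes>\<^sub>a h) = (f \<otimes>\<^sub>a (g \<otimes>\<^sub>a h)) \<cdot> \<a> (Dom C f) (Dom C g) (Dom C h)"
  using assoc_natural[of f "Dom C f" X g "Dom C g" Y h "Dom C h" Z] assms
  by (simp add: in_Hom_iff)

lemma lunit_natural_arr:
  "f \<in> Arr C \<Longrightarrow> Cod C f = X \<Longrightarrow> \<l> X \<cdot> (Ident C \<I> \<otimes>\<^sub>a f) = f \<cdot> \<l> (Dom C f)"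
  by (rule lunit_natural) (simp add: in_Hom_iff)

lemma runit_natural_arr:
  "f \<in> Arr C \<Longrightarrow> Cod C f = X \<Longrightarrow> \<r> X \<cdot> (f \<otimes>\<^sub>a Ident C \<I>) = f \<cdot> \<r> (Dom C f)"
  by (rule runit_natural) (simp add: in_Hom_iff)

section \<open>Coherence of the unit constraints\<close>

text \<open>Naturality of \<open>\<l>\<close> expresses \<open>f\<close> as the conjugate of \<open>Ident C \<I> \<otimes>\<^sub>a f\<close> by isomorphisms, so an equation
  between arrows may be tested after tensoring with the unit. This is what makes the unit
  coherences below accessible to the pentagon, which needs four factors.\<close>

lemma unit_tensor_faithful:
  assumes f: "f \<in> Hom C X Y" and g: "g \<in> Hom C X Y"
    and eq: "Ident C \<I> \<otimes>\<^sub>a f = Ident C \<I> \<otimes>\<^sub>a g"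
  shows "f = g"
proof (rule iso_cancel_right)
  have [simp]: "X \<in> Obj C"
    using f dom_obj by (auto simp: in_Hom_iff)
  show "is_iso C (\<l> X)" "Dom C f = Cod C (\<l> X)" "Dom C g = Cod C (\<l> X)" "f \<in> Arr C" "g \<in> Arr C"
    using f g by (simp_all add: in_Hom_iff)
  show "f \<cdot> \<l> X = g \<cdot> \<l> X"
    using lunit_natural[OF f] lunit_natural[OF g] by (simp only: eq)
qed

lemma tensor_unit_faithful:
  assumes f: "f \<in> Hom C X Y" and g: "g \<in> Hom C X Y"
    and eq: "f \<otimes>\<^sub>a Ident C \<I> = g \<otimes>\<^sub>a Ident C \<I>"
  shows "f = g"
proof (rule iso_cancel_right)
  have [simp]: "X \<in> Obj C"
    using f dom_obj by (auto simp: in_Hom_iff)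
  show "is_iso C (\<r> X)" "Dom C f = Cod C (\<r> X)" "Dom C g = Cod C (\<r> X)" "f \<in> Arr C" "g \<in> Arr C"
    using f g by (simp_all add: in_Hom_iff)
  show "f \<cdot> \<r> X = g \<cdot> \<r> X"
    using runit_natural[OF f] runit_natural[OF g] by (simp only: eq)
qed

text \<open>
  Tensor with \<open>\<I>\<close> on the left and precompose with the isomorphism \<open>?k\<close> appearing in the
  pentagon for \<open>\<I>, \<I>, X, Y\<close>. The pentagon turns the left-hand side into a composite on which the
  triangle for \<open>\<I>, X \<otimes> Y\<close> applies; the triangle for \<open>\<I>, X\<close> and naturality of \<open>\<a>\<close> lead back to the
  right-hand side.
\<close>

lemma lunit_tensor:
  assumes [simp]: "X \<in> Obj C" "Y \<in> Obj C"
  shows "\<l> (X \<otimes> Y) \<cdot> \<a> \<I> X Y = \<l> X \<otimes>\<^sub>a Ident C Y"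
proof (rule unit_tensor_faithful)
  let ?i = "Ident C \<I>" and ?y = "Ident C Y"
  let ?k = "\<a> \<I> (\<I> \<otimes> X) Y \<cdot> (\<a> \<I> \<I> X \<otimes>\<^sub>a ?y)"
  have "(?i \<otimes>\<^sub>a (\<l> (X \<otimes> Y) \<cdot> \<a> \<I> X Y)) \<cdot> ?k
      = (?i \<otimes>\<^sub>a \<l> (X \<otimes> Y)) \<cdot> ((?i \<otimes>\<^sub>a \<a> \<I> X Y) \<cdot> ?k)"
    by simp
  also have "\<dots> = (?i \<otimes>\<^sub>a \<l> (X \<otimes> Y)) \<cdot> (\<a> \<I> \<I> (X \<otimes> Y) \<cdot> \<a> (\<I> \<otimes> \<I>) X Y)"
    using pentagon[of \<I> \<I> X Y] by simp
  also have "\<dots> = ((?i \<otimes>\<^sub>a \<l> (X \<otimes> Y)) \<cdot> \<a> \<I> \<I> (X \<otimes> Y)) \<cdot> \<a> (\<I> \<otimes> \<I>) X Y"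
    by simp
  also have "\<dots> = (\<r> \<I> \<otimes>\<^sub>a (Ident C X \<otimes>\<^sub>a ?y)) \<cdot> \<a> (\<I> \<otimes> \<I>) X Y"
    by (subst triangle) simp_all
  also have "\<dots> = \<a> \<I> X Y \<cdot> ((\<r> \<I> \<otimes>\<^sub>a Ident C X) \<otimes>\<^sub>a ?y)"
    by (subst assoc_natural_arr) (simp_all del: tensor_ident)
  also have "\<dots> = \<a> \<I> X Y \<cdot> (((?i \<otimes>\<^sub>a \<l> X) \<otimes>\<^sub>a ?y) \<cdot> (\<a> \<I> \<I> X \<otimes>\<^sub>a ?y))"
    by (simp add: triangle)
  also have "\<dots> = (\<a> \<I> X Y \<cdot> ((?i \<otimes>\<^sub>a \<l> X) \<otimes>\<^sub>a ?y)) \<cdot> (\<a> \<I> \<I> X \<otimes>\<^sub>a ?y)"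
    by simp
  also have "\<dots> = (?i \<otimes>\<^sub>a (\<l> X \<otimes>\<^sub>a ?y)) \<cdot> ?k"
    by (subst assoc_natural_arr) simp_all
  finally show "?i \<otimes>\<^sub>a (\<l> (X \<otimes> Y) \<cdot> \<a> \<I> X Y) = ?i \<otimes>\<^sub>a (\<l> X \<otimes>\<^sub>a ?y)"
    by (rule iso_cancel_right[rotated -1]) (auto intro!: comp_iso)
qed (simp_all add: in_Hom_iff)

text \<open>The mirror image: tensor with \<open>\<I>\<close> on the right and use the pentagon for \<open>X, Y, \<I>, \<I>\<close>.\<close>

lemma runit_tensor:
  assumes [simp]: "X \<in> Obj C" "Y \<in> Obj C"
  shows "(Ident C X \<otimes>\<^sub>a \<r> Y) \<cdot> \<a> X Y \<I> = \<r> (X \<otimes> Y)"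
proof (rule tensor_unit_faithful)
  let ?i = "Ident C \<I>" and ?x = "Ident C X" and ?y = "Ident C Y"
  have "\<a> X Y \<I> \<cdot> (\<r> (X \<otimes> Y) \<otimes>\<^sub>a ?i)
      = \<a> X Y \<I> \<cdot> (((?x \<otimes>\<^sub>a ?y) \<otimes>\<^sub>a \<l> \<I>) \<cdot> \<a> (X \<otimes> Y) \<I> \<I>)"
    by (simp add: triangle)
  also have "\<dots> = (\<a> X Y \<I> \<cdot> ((?x \<otimes>\<^sub>a ?y) \<otimes>\<^sub>a \<l> \<I>)) \<cdot> \<a> (X \<otimes> Y) \<I> \<I>"
    by simp
  also have "\<dots> = (?x \<otimes>\<^sub>a (?y \<otimes>\<^sub>a \<l> \<I>)) \<cdot> (\<a> X Y (\<I> \<otimes> \<I>) \<cdot> \<a> (X \<otimes> Y) \<I> \<I>)"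
    by (subst assoc_natural_arr) simp_all
  also have "\<dots> = (?x \<otimes>\<^sub>a (?y \<otimes>\<^sub>a \<l> \<I>)) \<cdot> ((?x \<otimes>\<^sub>a \<a> Y \<I> \<I>)
      \<cdot> (\<a> X (Y \<otimes> \<I>) \<I> \<cdot> (\<a> X Y \<I> \<otimes>\<^sub>a ?i)))"
    using pentagon[of X Y \<I> \<I>] by simp
  also have "\<dots> = (?x \<otimes>\<^sub>a (\<r> Y \<otimes>\<^sub>a ?i)) \<cdot> (\<a> X (Y \<otimes> \<I>) \<I> \<cdot> (\<a> X Y \<I> \<otimes>\<^sub>a ?i))"
    by (simp add: triangle)
  also have "\<dots> = ((?x \<otimes>\<^sub>a (\<r> Y \<otimes>\<^sub>a ?i)) \<cdot> \<a> X (Y \<otimes> \<I>) \<I>) \<cdot> (\<a> X Y \<I> \<otimes>\<^sub>a ?i)"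
    by simp
  also have "\<dots> = (\<a> X Y \<I> \<cdot> ((?x \<otimes>\<^sub>a \<r> Y) \<otimes>\<^sub>a ?i)) \<cdot> (\<a> X Y \<I> \<otimes>\<^sub>a ?i)"
    by (subst assoc_natural_arr) simp_all
  also have "\<dots> = \<a> X Y \<I> \<cdot> (((?x \<otimes>\<^sub>a \<r> Y) \<cdot> \<a> X Y \<I>) \<otimes>\<^sub>a ?i)"
    by simp
  finally have "\<r> (X \<otimes> Y) \<otimes>\<^sub>a ?i = ((?x \<otimes>\<^sub>a \<r> Y) \<cdot> \<a> X Y \<I>) \<otimes>\<^sub>a ?i"
    by (rule iso_cancel_left[rotated -1]) auto
  then show "((?x \<otimes>\<^sub>a \<r> Y) \<cdot> \<a> X Y \<I>) \<otimes>\<^sub>a ?i = \<r> (X \<otimes> Y) \<otimes>\<^sub>a ?i" ..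
qed (simp_all add: in_Hom_iff)

text \<open>Naturality of \<open>\<l>\<close> at the arrow \<open>\<l> \<I>\<close> itself gives \<open>Ident C \<I> \<otimes>\<^sub>a \<l> \<I> = \<l> (\<I> \<otimes> \<I>)\<close>. After composing with
  \<open>\<a> \<I> \<I> \<I>\<close>, the left-hand side is \<open>\<r> \<I> \<otimes>\<^sub>a Ident C \<I>\<close> by the triangle and the right-hand side is
  \<open>\<l> \<I> \<otimes>\<^sub>a Ident C \<I>\<close> by the previous coherence for \<open>\<l>\<close>.\<close>

lemma lunit_unit_eq_runit_unit: "\<l> \<I> = \<r> \<I>"
proof (rule tensor_unit_faithful)
  have "\<l> \<I> \<cdot> (Ident C \<I> \<otimes>\<^sub>a \<l> \<I>) = \<l> \<I> \<cdot> \<l> (\<I> \<otimes> \<I>)"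
    by (simp add: lunit_natural_arr)
  then have "Ident C \<I> \<otimes>\<^sub>a \<l> \<I> = \<l> (\<I> \<otimes> \<I>)"
    by (rule iso_cancel_left[rotated -1]) auto
  then show "\<l> \<I> \<otimes>\<^sub>a Ident C \<I> = \<r> \<I> \<otimes>\<^sub>a Ident C \<I>"
    using lunit_tensor[of \<I> \<I>] triangle[of \<I> \<I>] by simp
qed (simp_all add: in_Hom_iff)

section \<open>Tensoring a list of objects\<close>

text \<open>The nesting ends in \<open>\<I>\<close> even for nonempty lists, so \<open>[X]\<close> stands for \<open>X \<otimes> \<I>\<close> and not for \<open>X\<close>. This keeps
  a single recursive case in every induction, at the price of a factor \<open>\<r> X\<close> in essential
  surjectivity.\<close>

fun tensor_list :: "'o list \<Rightarrow> 'o" where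
  "tensor_list [] = \<I>"
| "tensor_list (X # Xs) = X \<otimes> tensor_list Xs"

text \<open>The canonical isomorphism \<open>tensor_list Xs \<otimes> tensor_list Ys \<rightarrow> tensor_list (Xs @ Ys)\<close>.\<close>

fun glue :: "'o list \<Rightarrow> 'o list \<Rightarrow> 'a" where
  "glue [] Ys = \<l> (tensor_list Ys)"
| "glue (X # Xs) Ys = (Ident C X \<otimes>\<^sub>a glue Xs Ys) \<cdot> \<a> X (tensor_list Xs) (tensor_list Ys)"

lemma tensor_list_obj [simp]: "set Xs \<subseteq> Obj C \<Longrightarrow> tensor_list Xs \<in> Obj C"
  by (induction Xs) auto

lemma glue_arr [simp]:
  assumes "set Xs \<subseteq> Obj C" "set Ys \<subseteq> Obj C"
  shows "glue Xs Ys \<in> Arr C" "Dom C (glue Xs Ys) = tensor_list Xs \<otimes> tensor_list Ys"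
    "Cod C (glue Xs Ys) = tensor_list (Xs @ Ys)" "is_iso C (glue Xs Ys)"
proof -
  have "glue Xs Ys \<in> Hom C (tensor_list Xs \<otimes> tensor_list Ys) (tensor_list (Xs @ Ys))
      \<and> is_iso C (glue Xs Ys)"
    using assms by (induction Xs) (auto simp: in_Hom_iff intro!: comp_iso)
  then show "glue Xs Ys \<in> Arr C" "Dom C (glue Xs Ys) = tensor_list Xs \<otimes> tensor_list Ys"
    "Cod C (glue Xs Ys) = tensor_list (Xs @ Ys)" "is_iso C (glue Xs Ys)"
    by (auto simp: in_Hom_iff)
qed

lemma glue_Nil_right: "set Xs \<subseteq> Obj C \<Longrightarrow> glue Xs [] = \<r> (tensor_list Xs)"
  by (induction Xs) (simp_all add: lunit_unit_eq_runit_unit runit_tensor)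

text \<open>
  The coherence that carries the whole construction: together with \<open>glue_Nil_right\<close> it makes
  \<open>tensor_list\<close> a monoidal functor from lists under concatenation. Consing \<open>X\<close> precomposes
  each \<open>glue\<close> with an associator. On the left-hand side, naturality moves \<open>glue Xs Ys\<close> past it, so that the induction
  hypothesis applies under \<open>X \<otimes> -\<close>; the pentagon then reorganises the three associators, and
  naturality moves \<open>glue Ys Zs\<close> back out.
\<close>

lemma glue_assoc:
  assumes "set Xs \<subseteq> Obj C" and [simp]: "set Ys \<subseteq> Obj C" "set Zs \<subseteq> Obj C"
  shows "glue (Xs @ Ys) Zs \<cdot> (glue Xs Ys \<otimes>\<^sub>a Ident C (tensor_list Zs))
    = glue Xs (Ys @ Zs) \<cdot> (Ident C (tensor_list Xs) \<otimes>\<^sub>a glue Ys Zs)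
        \<cdot> \<a> (tensor_list Xs) (tensor_list Ys) (tensor_list Zs)"
  using assms(1)
proof (induction Xs)
  case Nil
  let ?B = "tensor_list Ys" and ?C = "tensor_list Zs"
  have "glue Ys Zs \<cdot> (\<l> ?B \<otimes>\<^sub>a Ident C ?C) = (glue Ys Zs \<cdot> \<l> (?B \<otimes> ?C)) \<cdot> \<a> \<I> ?B ?C"
    by (simp add: lunit_tensor)
  also have "glue Ys Zs \<cdot> \<l> (?B \<otimes> ?C) = \<l> (tensor_list (Ys @ Zs)) \<cdot> (Ident C \<I> \<otimes>\<^sub>a glue Ys Zs)"
    by (simp add: lunit_natural_arr)
  finally show ?case
    by simp
next
  case (Cons X Xs)
  let ?A = "tensor_list Xs" and ?B = "tensor_list Ys" and ?C = "tensor_list Zs"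
  let ?x = "Ident C X" and ?c = "Ident C ?C"
  have [simp]: "X \<in> Obj C" "set Xs \<subseteq> Obj C"
    using Cons.prems by auto
  have "glue ((X # Xs) @ Ys) Zs \<cdot> (glue (X # Xs) Ys \<otimes>\<^sub>a ?c)
      = (?x \<otimes>\<^sub>a glue (Xs @ Ys) Zs) \<cdot> ((\<a> X (tensor_list (Xs @ Ys)) ?C
          \<cdot> ((?x \<otimes>\<^sub>a glue Xs Ys) \<otimes>\<^sub>a ?c)) \<cdot> (\<a> X ?A ?B \<otimes>\<^sub>a ?c))"
    by simp
  also have "\<dots> = (?x \<otimes>\<^sub>a (glue (Xs @ Ys) Zs \<cdot> (glue Xs Ys \<otimes>\<^sub>a ?c)))
      \<cdot> (\<a> X (?A \<otimes> ?B) ?C \<cdot> (\<a> X ?A ?B \<otimes>\<^sub>a ?c))"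
    by (subst assoc_natural_arr) simp_all
  also have "\<dots> = (?x \<otimes>\<^sub>a (glue Xs (Ys @ Zs) \<cdot> (Ident C ?A \<otimes>\<^sub>a glue Ys Zs)))
      \<cdot> ((?x \<otimes>\<^sub>a \<a> ?A ?B ?C) \<cdot> (\<a> X (?A \<otimes> ?B) ?C \<cdot> (\<a> X ?A ?B \<otimes>\<^sub>a ?c)))"
    using Cons by simp
  also have "\<dots> = (?x \<otimes>\<^sub>a (glue Xs (Ys @ Zs) \<cdot> (Ident C ?A \<otimes>\<^sub>a glue Ys Zs)))
      \<cdot> (\<a> X ?A (?B \<otimes> ?C) \<cdot> \<a> (X \<otimes> ?A) ?B ?C)"
    using pentagon[of X ?A ?B ?C] by simp
  also have "\<dots> = (?x \<otimes>\<^sub>a glue Xs (Ys @ Zs))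
      \<cdot> (((?x \<otimes>\<^sub>a (Ident C ?A \<otimes>\<^sub>a glue Ys Zs)) \<cdot> \<a> X ?A (?B \<otimes> ?C)) \<cdot> \<a> (X \<otimes> ?A) ?B ?C)"
    by simp
  also have "(?x \<otimes>\<^sub>a (Ident C ?A \<otimes>\<^sub>a glue Ys Zs)) \<cdot> \<a> X ?A (?B \<otimes> ?C)
      = \<a> X ?A (tensor_list (Ys @ Zs)) \<cdot> ((?x \<otimes>\<^sub>a Ident C ?A) \<otimes>\<^sub>a glue Ys Zs)"
    by (subst assoc_natural_arr) (simp_all del: tensor_ident)
  finally show ?case
    by simp
qed

end

section \<open>Composing monoidal functors\<close>

context monoidal_functor
begin

declare fobj [simp] farr_ident [simp]

lemma farr_arr [simp]:
  assumes "f \<in> Arr C"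
  shows "FArr F f \<in> Arr D" "Dom D (FArr F f) = FObj F (Dom C f)"
    "Cod D (FArr F f) = FObj F (Cod C f)"
  using farr_hom[of f "Dom C f" "Cod C f"] assms by (simp_all add: in_Hom_iff)

lemma farr_comp_arr [simp]:
  "f \<in> Arr C \<Longrightarrow> g \<in> Arr C \<Longrightarrow> Cod C f = Dom C g
    \<Longrightarrow> FArr F (g \<cdot>\<^bsub>C\<^esub> f) = FArr F g \<cdot>\<^bsub>D\<^esub> FArr F f"
  by (rule farr_comp) (simp_all add: in_Hom_iff)

lemma ftensor_arr [simp]:
  assumes "X \<in> Obj C" "Y \<in> Obj C"
  shows "FTensor F X Y \<in> Arr D" "Dom D (FTensor F X Y) = FObj F X \<otimes>\<^bsub>D\<^esub> FObj F Y"
    "Cod D (FTensor F X Y) = FObj F (X \<otimes>\<^bsub>C\<^esub> Y)" "is_iso D (FTensor F X Y)"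
  using ftensor_hom[OF assms] ftensor_iso[OF assms] by (simp_all add: in_Hom_iff)

lemma funit_arr [simp]:
  "FUnit F \<in> Arr D" "Dom D (FUnit F) = \<I>\<^bsub>D\<^esub>" "Cod D (FUnit F) = FObj F \<I>\<^bsub>C\<^esub>"
  "is_iso D (FUnit F)"
  using funit_hom funit_iso by (simp_all add: in_Hom_iff)

lemma ftensor_natural_arr:
  "f \<in> Arr C \<Longrightarrow> g \<in> Arr C \<Longrightarrow> Cod C f = X \<Longrightarrow> Cod C g = Y
    \<Longrightarrow> FTensor F X Y \<cdot>\<^bsub>D\<^esub> (FArr F f \<otimes>\<^sub>a\<^bsub>D\<^esub> FArr F g)
      = FArr F (f \<otimes>\<^sub>a\<^bsub>C\<^esub> g) \<cdot>\<^bsub>D\<^esub> FTensor F (Dom C f) (Dom C g)"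
  by (rule ftensor_natural) (simp_all add: in_Hom_iff)

lemma farr_iso [simp]:
  assumes "is_iso C f"
  shows "is_iso D (FArr F f)"
proof (rule D.isoI)
  note [simp] = C.iso_arr[OF assms] C.inv_arr_simps[OF assms] C.inv_comp[OF assms]
  show "FArr F (inv\<^bsub>C\<^esub> f) \<in> Arr D"
    by simp
  show "FArr F (inv\<^bsub>C\<^esub> f) \<cdot>\<^bsub>D\<^esub> FArr F f = Ident D (Dom D (FArr F f))"
    by (simp flip: farr_comp_arr)
  show "FArr F f \<cdot>\<^bsub>D\<^esub> FArr F (inv\<^bsub>C\<^esub> f) = Ident D (Cod D (FArr F f))"
    by (simp flip: farr_comp_arr)
qed (use assms in \<open>simp_all add: C.iso_arr\<close>)

end

lemma (in monoidal_category) id_monoidal_functor: "monoidal_functor C C (id_functor C)"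
  by unfold_locales (simp_all add: id_functor_def in_Hom_iff)

text \<open>Each axiom for the composite is the axiom for \<open>F\<close> inside \<open>FArr G\<close>, pasted to the axiom for \<open>G\<close> along
  the naturality of \<open>FTensor G\<close> at a structure isomorphism of \<open>F\<close>.\<close>

lemma comp_monoidal_functor:
  assumes "monoidal_functor C D F" "monoidal_functor D E G"
  shows "monoidal_functor C E (comp_functor E G F)"
proof -
  interpret F: monoidal_functor C D F by fact
  interpret G: monoidal_functor D E G by fact
  let ?H = "comp_functor E G F"
  \<comment> \<open>the naturality square of \<open>FTensor F\<close> under \<open>G\<close>, with a further factor \<open>h\<close> so that it
    rewrites inside a composite reassociated to the right\<close>
  have ftensor_natural_image: "FArr G (FTensor F X Y) \<cdot>\<^bsub>E\<^esub> (FArr G (FArr F f \<otimes>\<^sub>a\<^bsub>D\<^esub> FArr F g) \<cdot>\<^bsub>E\<^esub> h)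
      = FArr G (FArr F (f \<otimes>\<^sub>a\<^bsub>C\<^esub> g)) \<cdot>\<^bsub>E\<^esub> (FArr G (FTensor F (Dom C f) (Dom C g)) \<cdot>\<^bsub>E\<^esub> h)"
    if "f \<in> Arr C" "g \<in> Arr C" "Cod C f = X" "Cod C g = Y" "h \<in> Arr E"
      "Cod E h = FObj G (FObj F (Dom C f) \<otimes>\<^bsub>D\<^esub> FObj F (Dom C g))" for f g h X Y
  proof -
    have "FArr G (FTensor F X Y \<cdot>\<^bsub>D\<^esub> (FArr F f \<otimes>\<^sub>a\<^bsub>D\<^esub> FArr F g)) \<cdot>\<^bsub>E\<^esub> h
        = FArr G (FArr F (f \<otimes>\<^sub>a\<^bsub>C\<^esub> g) \<cdot>\<^bsub>D\<^esub> FTensor F (Dom C f) (Dom C g)) \<cdot>\<^bsub>E\<^esub> h"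
      using that(1-4) by (simp only: F.ftensor_natural_arr)
    then show ?thesis
      using that by auto
  qed
  show ?thesis
  proof (intro monoidal_functor.intro monoidal_functor_axioms.intro)
    show "monoidal_category C" "monoidal_category E"
      by unfold_locales
  next
    fix f g X X' Y Y'
    assume "f \<in> Hom C X X'" "g \<in> Hom C Y Y'"
    then have [simp]: "f \<in> Arr C" "g \<in> Arr C" "Dom C f = X" "Cod C f = X'" "Dom C g = Y" "Cod C g = Y'"
      "X \<in> Obj C" "Y \<in> Obj C" "X' \<in> Obj C" "Y' \<in> Obj C"
      using F.C.dom_cod_obj by (auto simp: in_Hom_iff simp del: F.C.dom_cod_obj)
    show "FTensor ?H X' Y' \<cdot>\<^bsub>E\<^esub> (FArr ?H f \<otimes>\<^sub>a\<^bsub>E\<^esub> FArr ?H g) = FArr ?H (f \<otimes>\<^sub>a\<^bsub>C\<^esub> g) \<cdot>\<^bsub>E\<^esub> FTensor ?H X Y"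
      by (simp add: comp_functor_def G.ftensor_natural_arr ftensor_natural_image)
  next
    fix X Y Z
    assume [simp]: "X \<in> Obj C" "Y \<in> Obj C" "Z \<in> Obj C"
    let ?a = "FTensor F" and ?b = "FTensor G" and ?F = "FObj F"
    let ?FX = "?F X" and ?FY = "?F Y" and ?FZ = "?F Z"
    have "FArr ?H (\<a>\<^bsub>C\<^esub> X Y Z) \<cdot>\<^bsub>E\<^esub> FTensor ?H (X \<otimes>\<^bsub>C\<^esub> Y) Z \<cdot>\<^bsub>E\<^esub>
        (FTensor ?H X Y \<otimes>\<^sub>a\<^bsub>E\<^esub> Ident E (FObj ?H Z))
      = FArr G (FArr F (\<a>\<^bsub>C\<^esub> X Y Z)) \<cdot>\<^bsub>E\<^esub> FArr G (?a (X \<otimes>\<^bsub>C\<^esub> Y) Z) \<cdot>\<^bsub>E\<^esub>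
        (?b (?F (X \<otimes>\<^bsub>C\<^esub> Y)) ?FZ \<cdot>\<^bsub>E\<^esub> (FArr G (?a X Y) \<otimes>\<^sub>a\<^bsub>E\<^esub> FArr G (Ident D ?FZ))) \<cdot>\<^bsub>E\<^esub>
        (?b ?FX ?FY \<otimes>\<^sub>a\<^bsub>E\<^esub> Ident E (FObj G ?FZ))"
      by (simp add: comp_functor_def)
    also have "\<dots> = FArr G (FArr F (\<a>\<^bsub>C\<^esub> X Y Z) \<cdot>\<^bsub>D\<^esub> ?a (X \<otimes>\<^bsub>C\<^esub> Y) Z \<cdot>\<^bsub>D\<^esub> (?a X Y \<otimes>\<^sub>a\<^bsub>D\<^esub> Ident D ?FZ)) \<cdot>\<^bsub>E\<^esub>
        ?b (?FX \<otimes>\<^bsub>D\<^esub> ?FY) ?FZ \<cdot>\<^bsub>E\<^esub> (?b ?FX ?FY \<otimes>\<^sub>a\<^bsub>E\<^esub> Ident E (FObj G ?FZ))"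
      by (subst G.ftensor_natural_arr) simp_all
    also have "FArr F (\<a>\<^bsub>C\<^esub> X Y Z) \<cdot>\<^bsub>D\<^esub> ?a (X \<otimes>\<^bsub>C\<^esub> Y) Z \<cdot>\<^bsub>D\<^esub> (?a X Y \<otimes>\<^sub>a\<^bsub>D\<^esub> Ident D ?FZ)
        = ?a X (Y \<otimes>\<^bsub>C\<^esub> Z) \<cdot>\<^bsub>D\<^esub> (Ident D ?FX \<otimes>\<^sub>a\<^bsub>D\<^esub> ?a Y Z) \<cdot>\<^bsub>D\<^esub> \<a>\<^bsub>D\<^esub> ?FX ?FY ?FZ"
      by (simp add: F.fassoc)
    also have "FArr G \<dots> \<cdot>\<^bsub>E\<^esub> ?b (?FX \<otimes>\<^bsub>D\<^esub> ?FY) ?FZ \<cdot>\<^bsub>E\<^esub> (?b ?FX ?FY \<otimes>\<^sub>a\<^bsub>E\<^esub> Ident E (FObj G ?FZ))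
        = FArr G (?a X (Y \<otimes>\<^bsub>C\<^esub> Z)) \<cdot>\<^bsub>E\<^esub> FArr G (Ident D ?FX \<otimes>\<^sub>a\<^bsub>D\<^esub> ?a Y Z) \<cdot>\<^bsub>E\<^esub>
          (FArr G (\<a>\<^bsub>D\<^esub> ?FX ?FY ?FZ) \<cdot>\<^bsub>E\<^esub> ?b (?FX \<otimes>\<^bsub>D\<^esub> ?FY) ?FZ \<cdot>\<^bsub>E\<^esub>
            (?b ?FX ?FY \<otimes>\<^sub>a\<^bsub>E\<^esub> Ident E (FObj G ?FZ)))"
      by simp
    also have "\<dots> = FArr G (?a X (Y \<otimes>\<^bsub>C\<^esub> Z)) \<cdot>\<^bsub>E\<^esub>
          (FArr G (Ident D ?FX \<otimes>\<^sub>a\<^bsub>D\<^esub> ?a Y Z) \<cdot>\<^bsub>E\<^esub> ?b ?FX (?FY \<otimes>\<^bsub>D\<^esub> ?FZ)) \<cdot>\<^bsub>E\<^esub>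
          (Ident E (FObj G ?FX) \<otimes>\<^sub>a\<^bsub>E\<^esub> ?b ?FY ?FZ) \<cdot>\<^bsub>E\<^esub> \<a>\<^bsub>E\<^esub> (FObj G ?FX) (FObj G ?FY) (FObj G ?FZ)"
      by (subst G.fassoc) simp_all
    also have "FArr G (Ident D ?FX \<otimes>\<^sub>a\<^bsub>D\<^esub> ?a Y Z) \<cdot>\<^bsub>E\<^esub> ?b ?FX (?FY \<otimes>\<^bsub>D\<^esub> ?FZ)
        = ?b ?FX (?F (Y \<otimes>\<^bsub>C\<^esub> Z)) \<cdot>\<^bsub>E\<^esub> (FArr G (Ident D ?FX) \<otimes>\<^sub>a\<^bsub>E\<^esub> FArr G (?a Y Z))"
      by (subst G.ftensor_natural_arr) simp_all
    finally show "FArr ?H (\<a>\<^bsub>C\<^esub> X Y Z) \<cdot>\<^bsub>E\<^esub> FTensor ?H (X \<otimes>\<^bsub>C\<^esub> Y) Z \<cdot>\<^bsub>E\<^esub>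
        (FTensor ?H X Y \<otimes>\<^sub>a\<^bsub>E\<^esub> Ident E (FObj ?H Z))
      = FTensor ?H X (Y \<otimes>\<^bsub>C\<^esub> Z) \<cdot>\<^bsub>E\<^esub> (Ident E (FObj ?H X) \<otimes>\<^sub>a\<^bsub>E\<^esub> FTensor ?H Y Z)
        \<cdot>\<^bsub>E\<^esub> \<a>\<^bsub>E\<^esub> (FObj ?H X) (FObj ?H Y) (FObj ?H Z)"
      by (simp add: comp_functor_def)
  next
    fix X
    assume [simp]: "X \<in> Obj C"
    let ?I = "\<I>\<^bsub>C\<^esub>" and ?FX = "FObj F X"
    have "FArr ?H (\<l>\<^bsub>C\<^esub> X) \<cdot>\<^bsub>E\<^esub> FTensor ?H ?I X \<cdot>\<^bsub>E\<^esub> (FUnit ?H \<otimes>\<^sub>a\<^bsub>E\<^esub> Ident E (FObj ?H X))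
      = FArr G (FArr F (\<l>\<^bsub>C\<^esub> X)) \<cdot>\<^bsub>E\<^esub> FArr G (FTensor F ?I X) \<cdot>\<^bsub>E\<^esub>
        (FTensor G (FObj F ?I) ?FX \<cdot>\<^bsub>E\<^esub> (FArr G (FUnit F) \<otimes>\<^sub>a\<^bsub>E\<^esub> FArr G (Ident D ?FX))) \<cdot>\<^bsub>E\<^esub>
        (FUnit G \<otimes>\<^sub>a\<^bsub>E\<^esub> Ident E (FObj G ?FX))"
      by (simp add: comp_functor_def)
    also have "\<dots> = FArr G (FArr F (\<l>\<^bsub>C\<^esub> X) \<cdot>\<^bsub>D\<^esub> FTensor F ?I X \<cdot>\<^bsub>D\<^esub> (FUnit F \<otimes>\<^sub>a\<^bsub>D\<^esub> Ident D ?FX)) \<cdot>\<^bsub>E\<^esub>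
        FTensor G \<I>\<^bsub>D\<^esub> ?FX \<cdot>\<^bsub>E\<^esub> (FUnit G \<otimes>\<^sub>a\<^bsub>E\<^esub> Ident E (FObj G ?FX))"
      by (subst G.ftensor_natural_arr) simp_all
    also have "\<dots> = \<l>\<^bsub>E\<^esub> (FObj G ?FX)"
      by (simp only: F.flunit[OF \<open>X \<in> Obj C\<close>] G.flunit F.fobj[OF \<open>X \<in> Obj C\<close>])
    finally show "FArr ?H (\<l>\<^bsub>C\<^esub> X) \<cdot>\<^bsub>E\<^esub> FTensor ?H ?I X \<cdot>\<^bsub>E\<^esub> (FUnit ?H \<otimes>\<^sub>a\<^bsub>E\<^esub> Ident E (FObj ?H X))
        = \<l>\<^bsub>E\<^esub> (FObj ?H X)"
      by (simp add: comp_functor_def)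
    have "FArr ?H (\<r>\<^bsub>C\<^esub> X) \<cdot>\<^bsub>E\<^esub> FTensor ?H X ?I \<cdot>\<^bsub>E\<^esub> (Ident E (FObj ?H X) \<otimes>\<^sub>a\<^bsub>E\<^esub> FUnit ?H)
      = FArr G (FArr F (\<r>\<^bsub>C\<^esub> X)) \<cdot>\<^bsub>E\<^esub> FArr G (FTensor F X ?I) \<cdot>\<^bsub>E\<^esub>
        (FTensor G ?FX (FObj F ?I) \<cdot>\<^bsub>E\<^esub> (FArr G (Ident D ?FX) \<otimes>\<^sub>a\<^bsub>E\<^esub> FArr G (FUnit F))) \<cdot>\<^bsub>E\<^esub>
        (Ident E (FObj G ?FX) \<otimes>\<^sub>a\<^bsub>E\<^esub> FUnit G)"
      by (simp add: comp_functor_def)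
    also have "\<dots> = FArr G (FArr F (\<r>\<^bsub>C\<^esub> X) \<cdot>\<^bsub>D\<^esub> FTensor F X ?I \<cdot>\<^bsub>D\<^esub> (Ident D ?FX \<otimes>\<^sub>a\<^bsub>D\<^esub> FUnit F)) \<cdot>\<^bsub>E\<^esub>
        FTensor G ?FX \<I>\<^bsub>D\<^esub> \<cdot>\<^bsub>E\<^esub> (Ident E (FObj G ?FX) \<otimes>\<^sub>a\<^bsub>E\<^esub> FUnit G)"
      by (subst G.ftensor_natural_arr) simp_all
    also have "\<dots> = \<r>\<^bsub>E\<^esub> (FObj G ?FX)"
      by (simp only: F.frunit[OF \<open>X \<in> Obj C\<close>] G.frunit F.fobj[OF \<open>X \<in> Obj C\<close>])
    finally show "FArr ?H (\<r>\<^bsub>C\<^esub> X) \<cdot>\<^bsub>E\<^esub> FTensor ?H X ?I \<cdot>\<^bsub>E\<^esub> (Ident E (FObj ?H X) \<otimes>\<^sub>a\<^bsub>E\<^esub> FUnit ?H)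
        = \<r>\<^bsub>E\<^esub> (FObj ?H X)"
      by (simp add: comp_functor_def)
  qed (auto simp: comp_functor_def in_Hom_iff intro!: G.D.comp_iso)
qed

section \<open>Fully faithful, essentially surjective monoidal functors\<close>

text \<open>
  The structure isomorphisms of \<open>F\<close> are inverted to express the image of a tensor product of arrows
  and of each constraint in terms of the target category. Used as rewrite rules, these equations
  compute the image under \<open>F\<close> of any composite of structural arrows.
\<close>

context monoidal_functor
begin

lemma farr_tensor:
  assumes "f \<in> Arr C" "g \<in> Arr C"
  shows "FArr F (f \<otimes>\<^sub>a\<^bsub>C\<^esub> g) = FTensor F (Cod C f) (Cod C g) \<cdot>\<^bsub>D\<^esub> (FArr F f \<otimes>\<^sub>a\<^bsub>D\<^esub> FArr F g)
    \<cdot>\<^bsub>D\<^esub> inv\<^bsub>D\<^esub> FTensor F (Dom C f) (Dom C g)"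
proof -
  let ?\<phi> = "FTensor F (Dom C f) (Dom C g)"
  have "FArr F (f \<otimes>\<^sub>a\<^bsub>C\<^esub> g) = (FArr F (f \<otimes>\<^sub>a\<^bsub>C\<^esub> g) \<cdot>\<^bsub>D\<^esub> ?\<phi>) \<cdot>\<^bsub>D\<^esub> inv\<^bsub>D\<^esub> ?\<phi>"
    using assms by simp
  also have "FArr F (f \<otimes>\<^sub>a\<^bsub>C\<^esub> g) \<cdot>\<^bsub>D\<^esub> ?\<phi>
      = FTensor F (Cod C f) (Cod C g) \<cdot>\<^bsub>D\<^esub> (FArr F f \<otimes>\<^sub>a\<^bsub>D\<^esub> FArr F g)"
    using assms by (simp add: ftensor_natural_arr)
  finally show ?thesis
    using assms by simp
qed

lemma farr_assoc:
  assumes [simp]: "X \<in> Obj C" "Y \<in> Obj C" "Z \<in> Obj C"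
  shows "FArr F (\<a>\<^bsub>C\<^esub> X Y Z) = FTensor F X (Y \<otimes>\<^bsub>C\<^esub> Z) \<cdot>\<^bsub>D\<^esub> (Ident D (FObj F X) \<otimes>\<^sub>a\<^bsub>D\<^esub> FTensor F Y Z)
    \<cdot>\<^bsub>D\<^esub> \<a>\<^bsub>D\<^esub> (FObj F X) (FObj F Y) (FObj F Z)
    \<cdot>\<^bsub>D\<^esub> (inv\<^bsub>D\<^esub> FTensor F X Y \<otimes>\<^sub>a\<^bsub>D\<^esub> Ident D (FObj F Z)) \<cdot>\<^bsub>D\<^esub> inv\<^bsub>D\<^esub> FTensor F (X \<otimes>\<^bsub>C\<^esub> Y) Z"
proof -
  let ?u = "FTensor F (X \<otimes>\<^bsub>C\<^esub> Y) Z" and ?v = "FTensor F X Y" and ?z = "Ident D (FObj F Z)"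
  have "FArr F (\<a>\<^bsub>C\<^esub> X Y Z) = (FArr F (\<a>\<^bsub>C\<^esub> X Y Z) \<cdot>\<^bsub>D\<^esub> ?u \<cdot>\<^bsub>D\<^esub> (?v \<otimes>\<^sub>a\<^bsub>D\<^esub> ?z))
      \<cdot>\<^bsub>D\<^esub> (inv\<^bsub>D\<^esub> ?v \<otimes>\<^sub>a\<^bsub>D\<^esub> ?z) \<cdot>\<^bsub>D\<^esub> inv\<^bsub>D\<^esub> ?u"
    by simp
  then show ?thesis
    by (simp add: fassoc)
qed

lemma farr_lunit:
  assumes [simp]: "X \<in> Obj C"
  shows "FArr F (\<l>\<^bsub>C\<^esub> X) = \<l>\<^bsub>D\<^esub> (FObj F X) \<cdot>\<^bsub>D\<^esub> (inv\<^bsub>D\<^esub> FUnit F \<otimes>\<^sub>a\<^bsub>D\<^esub> Ident D (FObj F X))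
    \<cdot>\<^bsub>D\<^esub> inv\<^bsub>D\<^esub> FTensor F \<I>\<^bsub>C\<^esub> X"
  by (simp flip: flunit)

lemma farr_runit:
  assumes [simp]: "X \<in> Obj C"
  shows "FArr F (\<r>\<^bsub>C\<^esub> X) = \<r>\<^bsub>D\<^esub> (FObj F X) \<cdot>\<^bsub>D\<^esub> (Ident D (FObj F X) \<otimes>\<^sub>a\<^bsub>D\<^esub> inv\<^bsub>D\<^esub> FUnit F)
    \<cdot>\<^bsub>D\<^esub> inv\<^bsub>D\<^esub> FTensor F X \<I>\<^bsub>C\<^esub>"
  by (simp flip: frunit)

end

locale monoidal_weak_equivalence = monoidal_functor C D F
  for C :: "('o, 'a, 'm) monoidal_category_scheme"
    and D :: "('p, 'b, 'n) monoidal_category_scheme"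
    and F :: "('o, 'a, 'p, 'b) monoidal_functor" +
  assumes full: "\<lbrakk>X \<in> Obj C; Y \<in> Obj C; g \<in> Hom D (FObj F X) (FObj F Y)\<rbrakk>
      \<Longrightarrow> \<exists>f \<in> Hom C X Y. FArr F f = g"
    and faithful: "\<lbrakk>f \<in> Hom C X Y; f' \<in> Hom C X Y; FArr F f = FArr F f'\<rbrakk> \<Longrightarrow> f = f'"
    and ess_surj: "A \<in> Obj D \<Longrightarrow> \<exists>X \<in> Obj C. FObj F X \<cong>\<^bsub>D\<^esub> A"
begin

definition lift :: "'o \<Rightarrow> 'o \<Rightarrow> 'b \<Rightarrow> 'a" where
  "lift X Y g = (SOME f. f \<in> Hom C X Y \<and> FArr F f = g)"

text \<open>An object of \<open>C\<close> whose image is isomorphic to \<open>A\<close>, and an isomorphism witnessing this. The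
  latter will be the component at \<open>A\<close> of the isomorphism from the composite
  of \<open>F\<close> with its quasi-inverse to the identity of \<open>D\<close>.\<close>

definition approx :: "'p \<Rightarrow> 'o" where
  "approx A = (SOME X. X \<in> Obj C \<and> FObj F X \<cong>\<^bsub>D\<^esub> A)"

definition counit :: "'p \<Rightarrow> 'b" where
  "counit A = (SOME e. e \<in> Hom D (FObj F (approx A)) A \<and> is_iso D e)"

lemma lift [simp]:
  assumes "X \<in> Obj C" "Y \<in> Obj C" "g \<in> Arr D" "Dom D g = FObj F X" "Cod D g = FObj F Y"
  shows "lift X Y g \<in> Arr C" "Dom C (lift X Y g) = X" "Cod C (lift X Y g) = Y"
    "FArr F (lift X Y g) = g"
proof -
  have "g \<in> Hom D (FObj F X) (FObj F Y)"
    using assms by (simp add: in_Hom_iff)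
  then have "\<exists>f. f \<in> Hom C X Y \<and> FArr F f = g"
    using full assms(1,2) by blast
  from someI_ex[OF this] show "lift X Y g \<in> Arr C" "Dom C (lift X Y g) = X"
    "Cod C (lift X Y g) = Y" "FArr F (lift X Y g) = g"
    by (simp_all add: lift_def in_Hom_iff)
qed

lemma approx:
  assumes "A \<in> Obj D"
  shows "approx A \<in> Obj C" "FObj F (approx A) \<cong>\<^bsub>D\<^esub> A"
proof -
  have "\<exists>X. X \<in> Obj C \<and> FObj F X \<cong>\<^bsub>D\<^esub> A"
    using ess_surj[OF assms] by blast
  from someI_ex[OF this] show "approx A \<in> Obj C" "FObj F (approx A) \<cong>\<^bsub>D\<^esub> A"
    by (simp_all add: approx_def)
qed

lemma counit [simp]:
  assumes "A \<in> Obj D"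
  shows "counit A \<in> Arr D" "Dom D (counit A) = FObj F (approx A)" "Cod D (counit A) = A"
    "is_iso D (counit A)" "approx A \<in> Obj C"
proof -
  have "\<exists>e. e \<in> Hom D (FObj F (approx A)) A \<and> is_iso D e"
    using approx(2)[OF assms] by (auto simp: isomorphic_def)
  from someI_ex[OF this] show "counit A \<in> Arr D" "Dom D (counit A) = FObj F (approx A)"
    "Cod D (counit A) = A" "is_iso D (counit A)"
    by (simp_all add: counit_def in_Hom_iff)
qed (rule approx(1)[OF assms])

lemma faithful_arr:
  "f \<in> Arr C \<Longrightarrow> g \<in> Arr C \<Longrightarrow> Dom C f = Dom C g \<Longrightarrow> Cod C f = Cod C g
    \<Longrightarrow> FArr F f = FArr F g \<Longrightarrow> f = g"
  by (rule faithful[of f "Dom C g" "Cod C g"]) (simp_all add: in_Hom_iff)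

lemma lift_iso [simp]:
  assumes "X \<in> Obj C" "Y \<in> Obj C" "is_iso D g" "Dom D g = FObj F X" "Cod D g = FObj F Y"
  shows "is_iso C (lift X Y g)"
proof (rule C.isoI)
  note [simp] = D.iso_arr[OF assms(3)] D.inv_arr_simps[OF assms(3)] D.inv_comp[OF assms(3)] assms
  show "lift Y X (inv\<^bsub>D\<^esub> g) \<cdot>\<^bsub>C\<^esub> lift X Y g = Ident C (Dom C (lift X Y g))"
    by (rule faithful_arr) simp_all
  show "lift X Y g \<cdot>\<^bsub>C\<^esub> lift Y X (inv\<^bsub>D\<^esub> g) = Ident C (Cod C (lift X Y g))"
    by (rule faithful_arr) simp_all
qed (use assms in \<open>simp_all add: D.iso_arr\<close>)

text \<open>
  On arrows and on structure isomorphisms the values are forced by requiring \<open>counit\<close> to be a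
  monoidal natural isomorphism: naturality determines the image of \<open>FArr\<close> under \<open>F\<close>, and compatibility with tensor products and units
  determines the images of \<open>FTensor\<close> and \<open>FUnit\<close>. Full faithfulness lifts these arrows
  from \<open>D\<close> to \<open>C\<close>.
\<close>

definition quasi_inverse :: "('p, 'b, 'o, 'a) monoidal_functor" where
  "quasi_inverse =
     \<lparr>FObj = approx,
      FArr = (\<lambda>g. lift (approx (Dom D g)) (approx (Cod D g))
        (inv\<^bsub>D\<^esub> counit (Cod D g) \<cdot>\<^bsub>D\<^esub> g \<cdot>\<^bsub>D\<^esub> counit (Dom D g))),
      FTensor = (\<lambda>A B. lift (approx A \<otimes>\<^bsub>C\<^esub> approx B) (approx (A \<otimes>\<^bsub>D\<^esub> B))
        (inv\<^bsub>D\<^esub> counit (A \<otimes>\<^bsub>D\<^esub> B) \<cdot>\<^bsub>D\<^esub> (counit A \<otimes>\<^sub>a\<^bsub>D\<^esub> counit B)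
          \<cdot>\<^bsub>D\<^esub> inv\<^bsub>D\<^esub> FTensor F (approx A) (approx B))),
      FUnit = lift \<I>\<^bsub>C\<^esub> (approx \<I>\<^bsub>D\<^esub>) (inv\<^bsub>D\<^esub> counit \<I>\<^bsub>D\<^esub> \<cdot>\<^bsub>D\<^esub> inv\<^bsub>D\<^esub> FUnit F)\<rparr>"

text \<open>Every axiom is an equation between parallel arrows of \<open>C\<close> and is tested under the faithful functor \<open>F\<close>.
  There the lifts become explicit conjugates by \<open>counit\<close>, inner factors cancel, and what remains
  for a constraint is its naturality with respect to \<open>counit\<close>.\<close>

lemma quasi_inverse_monoidal_functor: "monoidal_functor D C quasi_inverse"
proof (intro monoidal_functor.intro monoidal_functor_axioms.intro)
  show "monoidal_category D" "monoidal_category C"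
    by unfold_locales
next
  fix A
  assume [simp]: "A \<in> Obj D"
  show "FArr quasi_inverse (Ident D A) = Ident C (FObj quasi_inverse A)"
    by (rule faithful_arr) (simp_all add: quasi_inverse_def)
  show "FArr quasi_inverse (\<l>\<^bsub>D\<^esub> A) \<cdot>\<^bsub>C\<^esub> FTensor quasi_inverse \<I>\<^bsub>D\<^esub> A \<cdot>\<^bsub>C\<^esub>
      (FUnit quasi_inverse \<otimes>\<^sub>a\<^bsub>C\<^esub> Ident C (FObj quasi_inverse A)) = \<l>\<^bsub>C\<^esub> (FObj quasi_inverse A)"
  proof (rule faithful_arr)
    let ?\<rho> = "counit A" and ?S = "approx A"
    have "\<l>\<^bsub>D\<^esub> A \<cdot>\<^bsub>D\<^esub> (inv\<^bsub>D\<^esub> FUnit F \<otimes>\<^sub>a\<^bsub>D\<^esub> ?\<rho>)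
        = (\<l>\<^bsub>D\<^esub> A \<cdot>\<^bsub>D\<^esub> (Ident D \<I>\<^bsub>D\<^esub> \<otimes>\<^sub>a\<^bsub>D\<^esub> ?\<rho>)) \<cdot>\<^bsub>D\<^esub> (inv\<^bsub>D\<^esub> FUnit F \<otimes>\<^sub>a\<^bsub>D\<^esub> Ident D (FObj F ?S))"
      by simp
    also have "\<l>\<^bsub>D\<^esub> A \<cdot>\<^bsub>D\<^esub> (Ident D \<I>\<^bsub>D\<^esub> \<otimes>\<^sub>a\<^bsub>D\<^esub> ?\<rho>) = ?\<rho> \<cdot>\<^bsub>D\<^esub> \<l>\<^bsub>D\<^esub> (FObj F ?S)"
      by (simp add: D.lunit_natural_arr)
    finally have *: "inv\<^bsub>D\<^esub> ?\<rho> \<cdot>\<^bsub>D\<^esub> (\<l>\<^bsub>D\<^esub> A \<cdot>\<^bsub>D\<^esub> (inv\<^bsub>D\<^esub> FUnit F \<otimes>\<^sub>a\<^bsub>D\<^esub> ?\<rho>)) \<cdot>\<^bsub>D\<^esub> inv\<^bsub>D\<^esub> FTensor F \<I>\<^bsub>C\<^esub> ?S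
      = FArr F (\<l>\<^bsub>C\<^esub> ?S)"
      by (simp add: farr_lunit)
    show "FArr F (FArr quasi_inverse (\<l>\<^bsub>D\<^esub> A) \<cdot>\<^bsub>C\<^esub> FTensor quasi_inverse \<I>\<^bsub>D\<^esub> A \<cdot>\<^bsub>C\<^esub>
        (FUnit quasi_inverse \<otimes>\<^sub>a\<^bsub>C\<^esub> Ident C (FObj quasi_inverse A)))
      = FArr F (\<l>\<^bsub>C\<^esub> (FObj quasi_inverse A))"
      using * by (simp add: quasi_inverse_def farr_tensor)
  qed (simp_all add: quasi_inverse_def)
  show "FArr quasi_inverse (\<r>\<^bsub>D\<^esub> A) \<cdot>\<^bsub>C\<^esub> FTensor quasi_inverse A \<I>\<^bsub>D\<^esub> \<cdot>\<^bsub>C\<^esub>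
      (Ident C (FObj quasi_inverse A) \<otimes>\<^sub>a\<^bsub>C\<^esub> FUnit quasi_inverse) = \<r>\<^bsub>C\<^esub> (FObj quasi_inverse A)"
  proof (rule faithful_arr)
    let ?\<rho> = "counit A" and ?S = "approx A"
    have "\<r>\<^bsub>D\<^esub> A \<cdot>\<^bsub>D\<^esub> (?\<rho> \<otimes>\<^sub>a\<^bsub>D\<^esub> inv\<^bsub>D\<^esub> FUnit F)
        = (\<r>\<^bsub>D\<^esub> A \<cdot>\<^bsub>D\<^esub> (?\<rho> \<otimes>\<^sub>a\<^bsub>D\<^esub> Ident D \<I>\<^bsub>D\<^esub>)) \<cdot>\<^bsub>D\<^esub> (Ident D (FObj F ?S) \<otimes>\<^sub>a\<^bsub>D\<^esub> inv\<^bsub>D\<^esub> FUnit F)"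
      by simp
    also have "\<r>\<^bsub>D\<^esub> A \<cdot>\<^bsub>D\<^esub> (?\<rho> \<otimes>\<^sub>a\<^bsub>D\<^esub> Ident D \<I>\<^bsub>D\<^esub>) = ?\<rho> \<cdot>\<^bsub>D\<^esub> \<r>\<^bsub>D\<^esub> (FObj F ?S)"
      by (simp add: D.runit_natural_arr)
    finally have *: "inv\<^bsub>D\<^esub> ?\<rho> \<cdot>\<^bsub>D\<^esub> (\<r>\<^bsub>D\<^esub> A \<cdot>\<^bsub>D\<^esub> (?\<rho> \<otimes>\<^sub>a\<^bsub>D\<^esub> inv\<^bsub>D\<^esub> FUnit F)) \<cdot>\<^bsub>D\<^esub> inv\<^bsub>D\<^esub> FTensor F ?S \<I>\<^bsub>C\<^esub>
      = FArr F (\<r>\<^bsub>C\<^esub> ?S)"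
      by (simp add: farr_runit)
    show "FArr F (FArr quasi_inverse (\<r>\<^bsub>D\<^esub> A) \<cdot>\<^bsub>C\<^esub> FTensor quasi_inverse A \<I>\<^bsub>D\<^esub> \<cdot>\<^bsub>C\<^esub>
        (Ident C (FObj quasi_inverse A) \<otimes>\<^sub>a\<^bsub>C\<^esub> FUnit quasi_inverse))
      = FArr F (\<r>\<^bsub>C\<^esub> (FObj quasi_inverse A))"
      using * by (simp add: quasi_inverse_def farr_tensor)
  qed (simp_all add: quasi_inverse_def)
next
  fix f g A B E
  assume "f \<in> Hom D A B" "g \<in> Hom D B E"
  then have [simp]: "f \<in> Arr D" "g \<in> Arr D" "Dom D f = A" "Cod D f = B" "Dom D g = B" "Cod D g = E"
    "A \<in> Obj D" "B \<in> Obj D" "E \<in> Obj D"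
    using D.dom_cod_obj by (auto simp: in_Hom_iff simp del: D.dom_cod_obj)
  show "FArr quasi_inverse (g \<cdot>\<^bsub>D\<^esub> f) = FArr quasi_inverse g \<cdot>\<^bsub>C\<^esub> FArr quasi_inverse f"
    by (rule faithful_arr) (simp_all add: quasi_inverse_def)
next
  fix f g A B A' B'
  assume "f \<in> Hom D A A'" "g \<in> Hom D B B'"
  then have [simp]: "f \<in> Arr D" "g \<in> Arr D" "Dom D f = A" "Cod D f = A'" "Dom D g = B" "Cod D g = B'"
    "A \<in> Obj D" "B \<in> Obj D" "A' \<in> Obj D" "B' \<in> Obj D"
    using D.dom_cod_obj by (auto simp: in_Hom_iff simp del: D.dom_cod_obj)
  show "FTensor quasi_inverse A' B' \<cdot>\<^bsub>C\<^esub> (FArr quasi_inverse f \<otimes>\<^sub>a\<^bsub>C\<^esub> FArr quasi_inverse g)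
      = FArr quasi_inverse (f \<otimes>\<^sub>a\<^bsub>D\<^esub> g) \<cdot>\<^bsub>C\<^esub> FTensor quasi_inverse A B"
    by (rule faithful_arr) (simp_all add: quasi_inverse_def farr_tensor)
next
  fix X Y Z
  assume [simp]: "X \<in> Obj D" "Y \<in> Obj D" "Z \<in> Obj D"
  let ?S = approx and ?\<rho> = counit and ?\<phi> = "FTensor F" and ?Q = quasi_inverse
  show "FArr ?Q (\<a>\<^bsub>D\<^esub> X Y Z) \<cdot>\<^bsub>C\<^esub> FTensor ?Q (X \<otimes>\<^bsub>D\<^esub> Y) Z \<cdot>\<^bsub>C\<^esub> (FTensor ?Q X Y \<otimes>\<^sub>a\<^bsub>C\<^esub> Ident C (FObj ?Q Z))
      = FTensor ?Q X (Y \<otimes>\<^bsub>D\<^esub> Z) \<cdot>\<^bsub>C\<^esub> (Ident C (FObj ?Q X) \<otimes>\<^sub>a\<^bsub>C\<^esub> FTensor ?Q Y Z)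
        \<cdot>\<^bsub>C\<^esub> \<a>\<^bsub>C\<^esub> (FObj ?Q X) (FObj ?Q Y) (FObj ?Q Z)" (is "?lhs = ?rhs")
  proof (rule faithful_arr)
    have "\<a>\<^bsub>D\<^esub> X Y Z \<cdot>\<^bsub>D\<^esub> (((?\<rho> X \<otimes>\<^sub>a\<^bsub>D\<^esub> ?\<rho> Y) \<cdot>\<^bsub>D\<^esub> inv\<^bsub>D\<^esub> ?\<phi> (?S X) (?S Y)) \<otimes>\<^sub>a\<^bsub>D\<^esub> ?\<rho> Z)
        = (\<a>\<^bsub>D\<^esub> X Y Z \<cdot>\<^bsub>D\<^esub> ((?\<rho> X \<otimes>\<^sub>a\<^bsub>D\<^esub> ?\<rho> Y) \<otimes>\<^sub>a\<^bsub>D\<^esub> ?\<rho> Z))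
          \<cdot>\<^bsub>D\<^esub> (inv\<^bsub>D\<^esub> ?\<phi> (?S X) (?S Y) \<otimes>\<^sub>a\<^bsub>D\<^esub> Ident D (FObj F (?S Z)))"
      by simp
    also have "\<a>\<^bsub>D\<^esub> X Y Z \<cdot>\<^bsub>D\<^esub> ((?\<rho> X \<otimes>\<^sub>a\<^bsub>D\<^esub> ?\<rho> Y) \<otimes>\<^sub>a\<^bsub>D\<^esub> ?\<rho> Z)
        = (?\<rho> X \<otimes>\<^sub>a\<^bsub>D\<^esub> (?\<rho> Y \<otimes>\<^sub>a\<^bsub>D\<^esub> ?\<rho> Z)) \<cdot>\<^bsub>D\<^esub> \<a>\<^bsub>D\<^esub> (FObj F (?S X)) (FObj F (?S Y)) (FObj F (?S Z))"
      by (simp add: D.assoc_natural_arr)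
    finally have nat: "\<a>\<^bsub>D\<^esub> X Y Z
          \<cdot>\<^bsub>D\<^esub> (((?\<rho> X \<otimes>\<^sub>a\<^bsub>D\<^esub> ?\<rho> Y) \<cdot>\<^bsub>D\<^esub> inv\<^bsub>D\<^esub> ?\<phi> (?S X) (?S Y)) \<otimes>\<^sub>a\<^bsub>D\<^esub> ?\<rho> Z)
        = (?\<rho> X \<otimes>\<^sub>a\<^bsub>D\<^esub> (?\<rho> Y \<otimes>\<^sub>a\<^bsub>D\<^esub> ?\<rho> Z)) \<cdot>\<^bsub>D\<^esub> \<a>\<^bsub>D\<^esub> (FObj F (?S X)) (FObj F (?S Y)) (FObj F (?S Z))
          \<cdot>\<^bsub>D\<^esub> (inv\<^bsub>D\<^esub> ?\<phi> (?S X) (?S Y) \<otimes>\<^sub>a\<^bsub>D\<^esub> Ident D (FObj F (?S Z)))"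
      by simp
    have "FArr F ?lhs = inv\<^bsub>D\<^esub> ?\<rho> (X \<otimes>\<^bsub>D\<^esub> (Y \<otimes>\<^bsub>D\<^esub> Z)) \<cdot>\<^bsub>D\<^esub> (\<a>\<^bsub>D\<^esub> X Y Z
          \<cdot>\<^bsub>D\<^esub> (((?\<rho> X \<otimes>\<^sub>a\<^bsub>D\<^esub> ?\<rho> Y) \<cdot>\<^bsub>D\<^esub> inv\<^bsub>D\<^esub> ?\<phi> (?S X) (?S Y)) \<otimes>\<^sub>a\<^bsub>D\<^esub> ?\<rho> Z))
          \<cdot>\<^bsub>D\<^esub> inv\<^bsub>D\<^esub> ?\<phi> (?S X \<otimes>\<^bsub>C\<^esub> ?S Y) (?S Z)"
      by (simp add: quasi_inverse_def farr_tensor)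
    also have "\<dots> = FArr F ?rhs"
      unfolding nat by (simp add: quasi_inverse_def farr_tensor farr_assoc)
    finally show "FArr F ?lhs = FArr F ?rhs" .
  qed (simp_all add: quasi_inverse_def)
qed (auto simp: quasi_inverse_def in_Hom_iff intro!: lift_iso D.comp_iso)

text \<open>The isomorphism from the other composite to the identity of \<open>C\<close> is the lift of \<open>counit\<close> at
  the objects \<open>FObj F X\<close>.\<close>

theorem monoidally_equivalent: "monoidally_equivalent D C"
proof -
  let ?Q = quasi_inverse
  let ?\<eta> = "\<lambda>X. lift (approx (FObj F X)) X (counit (FObj F X))"
  interpret Q: monoidal_functor D C ?Q
    by (rule quasi_inverse_monoidal_functor)
  have F: "monoidal_functor C D F"
    by unfold_locales
  have "monoidal_nat_iso D D (comp_functor D F ?Q) (id_functor D) counit"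
  proof (intro monoidal_nat_iso.intro monoidal_nat_iso_axioms.intro)
    show "monoidal_functor D D (comp_functor D F ?Q)"
      by (rule comp_monoidal_functor[OF quasi_inverse_monoidal_functor F])
    show "monoidal_functor D D (id_functor D)"
      by (rule D.id_monoidal_functor)
  next
    fix f A B
    assume "f \<in> Hom D A B"
    then have [simp]: "f \<in> Arr D" "Dom D f = A" "Cod D f = B" "A \<in> Obj D" "B \<in> Obj D"
      using D.dom_cod_obj by (auto simp: in_Hom_iff simp del: D.dom_cod_obj)
    show "counit B \<cdot>\<^bsub>D\<^esub> FArr (comp_functor D F ?Q) f = FArr (id_functor D) f \<cdot>\<^bsub>D\<^esub> counit A"
      by (simp add: comp_functor_def id_functor_def quasi_inverse_def)
  qed (simp_all add: comp_functor_def id_functor_def quasi_inverse_def in_Hom_iff)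
  moreover have "monoidal_nat_iso C C (comp_functor C ?Q F) (id_functor C) ?\<eta>"
  proof (intro monoidal_nat_iso.intro monoidal_nat_iso_axioms.intro)
    show "monoidal_functor C C (comp_functor C ?Q F)"
      by (rule comp_monoidal_functor[OF F quasi_inverse_monoidal_functor])
    show "monoidal_functor C C (id_functor C)"
      by (rule C.id_monoidal_functor)
  next
    fix f X Y
    assume "f \<in> Hom C X Y"
    then have [simp]: "f \<in> Arr C" "Dom C f = X" "Cod C f = Y" "X \<in> Obj C" "Y \<in> Obj C"
      using C.dom_cod_obj by (auto simp: in_Hom_iff simp del: C.dom_cod_obj)
    show "?\<eta> Y \<cdot>\<^bsub>C\<^esub> FArr (comp_functor C ?Q F) f = FArr (id_functor C) f \<cdot>\<^bsub>C\<^esub> ?\<eta> X"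
      by (rule faithful_arr) (simp_all add: comp_functor_def id_functor_def quasi_inverse_def)
  next
    fix X Y
    assume [simp]: "X \<in> Obj C" "Y \<in> Obj C"
    show "?\<eta> (X \<otimes>\<^bsub>C\<^esub> Y) \<cdot>\<^bsub>C\<^esub> FTensor (comp_functor C ?Q F) X Y
        = FTensor (id_functor C) X Y \<cdot>\<^bsub>C\<^esub> (?\<eta> X \<otimes>\<^sub>a\<^bsub>C\<^esub> ?\<eta> Y)"
      by (rule faithful_arr)
        (simp_all add: comp_functor_def id_functor_def quasi_inverse_def farr_tensor)
  next
    show "?\<eta> \<I>\<^bsub>C\<^esub> \<cdot>\<^bsub>C\<^esub> FUnit (comp_functor C ?Q F) = FUnit (id_functor C)"
      by (rule faithful_arr) (simp_all add: comp_functor_def id_functor_def quasi_inverse_def)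
  qed (simp_all add: comp_functor_def id_functor_def quasi_inverse_def in_Hom_iff)
  ultimately show ?thesis
    unfolding monoidally_equivalent_def using F quasi_inverse_monoidal_functor by blast
qed

end

section \<open>The strictification\<close>

context monoidal_category
begin

text \<open>The tensor product of arrows \<open>f : Xs \<rightarrow> Ys\<close> and \<open>g : Xs' \<rightarrow> Ys'\<close> between lists, as an arrow of
  \<open>C\<close>.\<close>

definition glued_tensor :: "'o list \<Rightarrow> 'o list \<Rightarrow> 'o list \<Rightarrow> 'o list \<Rightarrow> 'a \<Rightarrow> 'a \<Rightarrow> 'a" where
  "glued_tensor Xs Xs' Ys Ys' f g = glue Ys Ys' \<cdot> (f \<otimes>\<^sub>a g) \<cdot> inv (glue Xs Xs')"

text \<open>An arrow carries its source and target lists because different lists may have the same product in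
  \<open>C\<close>.\<close>

definition strictification :: "('o list, 'o list \<times> 'a \<times> 'o list) monoidal_category" where
  "strictification =
     \<lparr>Obj = {Xs. set Xs \<subseteq> Obj C},
      Arr = {(Xs, f, Ys). set Xs \<subseteq> Obj C \<and> set Ys \<subseteq> Obj C \<and>
        f \<in> Hom C (tensor_list Xs) (tensor_list Ys)},
      Dom = fst,
      Cod = (\<lambda>f. snd (snd f)),
      Ident = (\<lambda>Xs. (Xs, Ident C (tensor_list Xs), Xs)),
      Comp = (\<lambda>g f. (fst f, fst (snd g) \<cdot> fst (snd f), snd (snd g))),
      TensorObj = (@),
      TensorArr = (\<lambda>(Xs, f, Ys) (Xs', g, Ys'). (Xs @ Xs', glued_tensor Xs Xs' Ys Ys' f g, Ys @ Ys')),
      UnitObj = [],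
      Assoc = (\<lambda>Xs Ys Zs. (Xs @ Ys @ Zs, Ident C (tensor_list (Xs @ Ys @ Zs)), Xs @ Ys @ Zs)),
      LUnit = (\<lambda>Xs. (Xs, Ident C (tensor_list Xs), Xs)),
      RUnit = (\<lambda>Xs. (Xs, Ident C (tensor_list Xs), Xs))\<rparr>"

lemma glued_tensor_arr [simp]:
  assumes "set Xs \<subseteq> Obj C" "set Xs' \<subseteq> Obj C" "set Ys \<subseteq> Obj C" "set Ys' \<subseteq> Obj C"
    "f \<in> Arr C" "g \<in> Arr C" "Dom C f = tensor_list Xs" "Cod C f = tensor_list Ys"
    "Dom C g = tensor_list Xs'" "Cod C g = tensor_list Ys'"
  shows "glued_tensor Xs Xs' Ys Ys' f g \<in> Arr C"
    "Dom C (glued_tensor Xs Xs' Ys Ys' f g) = tensor_list (Xs @ Xs')"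
    "Cod C (glued_tensor Xs Xs' Ys Ys' f g) = tensor_list (Ys @ Ys')"
  using assms by (simp_all add: glued_tensor_def)

lemma glued_tensor_glue:
  assumes "set Xs \<subseteq> Obj C" "set Xs' \<subseteq> Obj C" "set Ys \<subseteq> Obj C" "set Ys' \<subseteq> Obj C"
    "f \<in> Arr C" "g \<in> Arr C" "Dom C f = tensor_list Xs" "Cod C f = tensor_list Ys"
    "Dom C g = tensor_list Xs'" "Cod C g = tensor_list Ys'"
  shows "glued_tensor Xs Xs' Ys Ys' f g \<cdot> glue Xs Xs' = glue Ys Ys' \<cdot> (f \<otimes>\<^sub>a g)"
  using assms by (simp add: glued_tensor_def)

text \<open>Both sides are conjugates of a triple tensor product of \<open>f\<close>, \<open>g\<close> and \<open>h\<close>, bracketed to the left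
  or to the right. By \<open>glue_assoc\<close> the conjugating isomorphisms differ by an associator, which
  naturality moves across the triple product.\<close>

lemma glued_tensor_assoc:
  assumes [simp]: "set X \<subseteq> Obj C" "set X' \<subseteq> Obj C" "set X'' \<subseteq> Obj C"
    "set Y \<subseteq> Obj C" "set Y' \<subseteq> Obj C" "set Y'' \<subseteq> Obj C"
    and f [simp]: "f \<in> Arr C" "Dom C f = tensor_list X" "Cod C f = tensor_list Y"
    and g [simp]: "g \<in> Arr C" "Dom C g = tensor_list X'" "Cod C g = tensor_list Y'"
    and h [simp]: "h \<in> Arr C" "Dom C h = tensor_list X''" "Cod C h = tensor_list Y''"
  shows "glued_tensor (X @ X') X'' (Y @ Y') Y'' (glued_tensor X X' Y Y' f g) h
    = glued_tensor X (X' @ X'') Y (Y' @ Y'') f (glued_tensor X' X'' Y' Y'' g h)" (is "?l = ?r")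
proof (rule iso_cancel_right)
  let ?T = tensor_list
  let ?k = "glue (X @ X') X'' \<cdot> (glue X X' \<otimes>\<^sub>a Ident C (?T X''))"
  have "?l \<cdot> ?k = (?l \<cdot> glue (X @ X') X'') \<cdot> (glue X X' \<otimes>\<^sub>a Ident C (?T X''))"
    by (simp del: append_assoc)
  also have "\<dots> = glue (Y @ Y') Y'' \<cdot> ((glued_tensor X X' Y Y' f g \<cdot> glue X X') \<otimes>\<^sub>a h)"
    by (subst glued_tensor_glue) (simp_all del: append_assoc)
  also have "\<dots> = (glue (Y @ Y') Y'' \<cdot> (glue Y Y' \<otimes>\<^sub>a Ident C (?T Y''))) \<cdot> ((f \<otimes>\<^sub>a g) \<otimes>\<^sub>a h)"
    by (subst glued_tensor_glue) (simp_all del: append_assoc)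
  also have "\<dots> = glue Y (Y' @ Y'') \<cdot> (Ident C (?T Y) \<otimes>\<^sub>a glue Y' Y'') \<cdot>
      (\<a> (?T Y) (?T Y') (?T Y'') \<cdot> ((f \<otimes>\<^sub>a g) \<otimes>\<^sub>a h))"
    by (subst glue_assoc) simp_all
  also have "\<dots> = glue Y (Y' @ Y'') \<cdot> (f \<otimes>\<^sub>a (glue Y' Y'' \<cdot> (g \<otimes>\<^sub>a h))) \<cdot> \<a> (?T X) (?T X') (?T X'')"
    by (simp add: assoc_natural_arr)
  also have "\<dots> = glue Y (Y' @ Y'') \<cdot> (f \<otimes>\<^sub>a (glued_tensor X' X'' Y' Y'' g h \<cdot> glue X' X''))
      \<cdot> \<a> (?T X) (?T X') (?T X'')"
    by (subst glued_tensor_glue) simp_all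
  also have "\<dots> = (glue Y (Y' @ Y'') \<cdot> (f \<otimes>\<^sub>a glued_tensor X' X'' Y' Y'' g h))
      \<cdot> ((Ident C (?T X) \<otimes>\<^sub>a glue X' X'') \<cdot> \<a> (?T X) (?T X') (?T X''))"
    by simp
  also have "\<dots> = (?r \<cdot> glue X (X' @ X''))
      \<cdot> ((Ident C (?T X) \<otimes>\<^sub>a glue X' X'') \<cdot> \<a> (?T X) (?T X') (?T X''))"
    by (subst glued_tensor_glue) simp_all
  also have "\<dots> = ?r \<cdot> ?k"
    by (subst glue_assoc) simp_all
  finally show "?l \<cdot> ?k = ?r \<cdot> ?k" .
  show "is_iso C ?k"
    by (auto intro!: comp_iso)
qed simp_all

text \<open>Gluing an empty list on either side is a unit constraint, so these are the naturality squares of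
  \<open>\<l>\<close> and \<open>\<r>\<close>.\<close>

lemma glued_tensor_unit:
  assumes "set Xs \<subseteq> Obj C" "set Ys \<subseteq> Obj C"
    "f \<in> Arr C" "Dom C f = tensor_list Xs" "Cod C f = tensor_list Ys"
  shows "glued_tensor [] Xs [] Ys (Ident C \<I>) f = f"
    and "glued_tensor Xs [] Ys [] f (Ident C \<I>) = f"
proof -
  have "glued_tensor [] Xs [] Ys (Ident C \<I>) f
      = (\<l> (tensor_list Ys) \<cdot> (Ident C \<I> \<otimes>\<^sub>a f)) \<cdot> inv (\<l> (tensor_list Xs))"
    using assms by (simp add: glued_tensor_def)
  also have "\<dots> = f"
    using assms by (subst lunit_natural_arr) simp_all
  finally show "glued_tensor [] Xs [] Ys (Ident C \<I>) f = f" .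
  have "glued_tensor Xs [] Ys [] f (Ident C \<I>)
      = (\<r> (tensor_list Ys) \<cdot> (f \<otimes>\<^sub>a Ident C \<I>)) \<cdot> inv (\<r> (tensor_list Xs))"
    using assms by (simp add: glued_tensor_def glue_Nil_right)
  also have "\<dots> = f"
    using assms by (subst runit_natural_arr) simp_all
  finally show "glued_tensor Xs [] Ys [] f (Ident C \<I>) = f" .
qed

lemma strictification_simps [simp]:
  "Obj strictification = {Xs. set Xs \<subseteq> Obj C}"
  "Ident strictification Xs = (Xs, Ident C (tensor_list Xs), Xs)"
  "(Zs, g, Ws) \<cdot>\<^bsub>strictification\<^esub> (Xs, f, Ys) = (Xs, g \<cdot> f, Ws)"
  "Xs \<otimes>\<^bsub>strictification\<^esub> Ys = Xs @ Ys"
  "(Xs, f, Ys) \<otimes>\<^sub>a\<^bsub>strictification\<^esub> (Xs', g, Ys')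
    = (Xs @ Xs', glued_tensor Xs Xs' Ys Ys' f g, Ys @ Ys')"
  "\<I>\<^bsub>strictification\<^esub> = []"
  "\<a>\<^bsub>strictification\<^esub> Xs Ys Zs = (Xs @ Ys @ Zs, Ident C (tensor_list (Xs @ Ys @ Zs)), Xs @ Ys @ Zs)"
  "\<l>\<^bsub>strictification\<^esub> Xs = (Xs, Ident C (tensor_list Xs), Xs)"
  "\<r>\<^bsub>strictification\<^esub> Xs = (Xs, Ident C (tensor_list Xs), Xs)"
  "Dom strictification (Xs, f, Ys) = Xs"
  "Cod strictification (Xs, f, Ys) = Ys"
  "(Xs, f, Ys) \<in> Arr strictification \<longleftrightarrow> set Xs \<subseteq> Obj C \<and> set Ys \<subseteq> Obj C \<and>
     f \<in> Arr C \<and> Dom C f = tensor_list Xs \<and> Cod C f = tensor_list Ys"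
  by (simp_all add: strictification_def in_Hom_iff)

lemma strictification_HomE:
  assumes "f \<in> Hom strictification Xs Ys"
  obtains f' where "f = (Xs, f', Ys)" "set Xs \<subseteq> Obj C" "set Ys \<subseteq> Obj C"
    "f' \<in> Arr C" "Dom C f' = tensor_list Xs" "Cod C f' = tensor_list Ys"
  using assms by (cases f) (auto simp: in_Hom_iff)

lemma strictification_category: "category strictification"
proof
  fix f
  assume "f \<in> Arr strictification"
  then show "Dom strictification f \<in> Obj strictification" "Cod strictification f \<in> Obj strictification"
    by (cases f; simp)+
qed (((elim strictification_HomE)?, simp add: in_Hom_iff)+)

lemma strictification_iso:
  assumes "(Xs, f, Ys) \<in> Arr strictification" "is_iso C f"
  shows "is_iso strictification (Xs, f, Ys)"
proof -
  interpret S: category strictification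
    by (rule strictification_category)
  show ?thesis
    by (rule S.isoI[of _ "(Ys, inv f, Xs)"]) (use assms in simp_all)
qed

lemma strictification_ident_iso:
  "set Xs \<subseteq> Obj C \<Longrightarrow> is_iso strictification (Xs, Ident C (tensor_list Xs), Xs)"
  by (rule strictification_iso) simp_all

lemma glued_tensor_ident [simp]:
  assumes "set Xs \<subseteq> Obj C" "set Ys \<subseteq> Obj C"
  shows "glued_tensor Xs Ys Xs Ys (Ident C (tensor_list Xs)) (Ident C (tensor_list Ys))
    = Ident C (tensor_list (Xs @ Ys))"
  using assms by (simp add: glued_tensor_def)

text \<open>The pentagon and the triangle hold because all arrows in them are identities. What has content is
  the naturality of the identity constraints, which says that the tensor product
  of arrows is strictly associative and unital.\<close>

lemma strictification_monoidal_category: "monoidal_category strictification"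
proof (intro monoidal_category.intro monoidal_category_axioms.intro)
  show "category strictification"
    by (rule strictification_category)
next
  fix f g X X' Y Y'
  assume "f \<in> Hom strictification X X'" "g \<in> Hom strictification Y Y'"
  then show "f \<otimes>\<^sub>a\<^bsub>strictification\<^esub> g
      \<in> Hom strictification (X \<otimes>\<^bsub>strictification\<^esub> Y) (X' \<otimes>\<^bsub>strictification\<^esub> Y')"
    by (elim strictification_HomE; simp add: in_Hom_iff)+
next
  fix f f' g g' X X' X'' Y Y' Y''
  assume "f \<in> Hom strictification X X'" "f' \<in> Hom strictification X' X''"
    "g \<in> Hom strictification Y Y'" "g' \<in> Hom strictification Y' Y''"
  then show "(f' \<cdot>\<^bsub>strictification\<^esub> f) \<otimes>\<^sub>a\<^bsub>strictification\<^esub> (g' \<cdot>\<^bsub>strictification\<^esub> g)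
      = (f' \<otimes>\<^sub>a\<^bsub>strictification\<^esub> g') \<cdot>\<^bsub>strictification\<^esub> (f \<otimes>\<^sub>a\<^bsub>strictification\<^esub> g)"
    by (elim strictification_HomE; simp add: glued_tensor_def)+
next
  fix f g h X X' Y Y' Z Z'
  assume "f \<in> Hom strictification X X'" "g \<in> Hom strictification Y Y'" "h \<in> Hom strictification Z Z'"
  then show "\<a>\<^bsub>strictification\<^esub> X' Y' Z' \<cdot>\<^bsub>strictification\<^esub> ((f \<otimes>\<^sub>a\<^bsub>strictification\<^esub> g) \<otimes>\<^sub>a\<^bsub>strictification\<^esub> h)
      = (f \<otimes>\<^sub>a\<^bsub>strictification\<^esub> (g \<otimes>\<^sub>a\<^bsub>strictification\<^esub> h)) \<cdot>\<^bsub>strictification\<^esub> \<a>\<^bsub>strictification\<^esub> X Y Z"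
    by (elim strictification_HomE; simp add: glued_tensor_assoc)+
next
  fix f X Y
  assume "f \<in> Hom strictification X Y"
  then show "\<l>\<^bsub>strictification\<^esub> Y \<cdot>\<^bsub>strictification\<^esub>
        (Ident strictification \<I>\<^bsub>strictification\<^esub> \<otimes>\<^sub>a\<^bsub>strictification\<^esub> f)
      = f \<cdot>\<^bsub>strictification\<^esub> \<l>\<^bsub>strictification\<^esub> X"
    and "\<r>\<^bsub>strictification\<^esub> Y \<cdot>\<^bsub>strictification\<^esub>
        (f \<otimes>\<^sub>a\<^bsub>strictification\<^esub> Ident strictification \<I>\<^bsub>strictification\<^esub>)
      = f \<cdot>\<^bsub>strictification\<^esub> \<r>\<^bsub>strictification\<^esub> X"
    by (elim strictification_HomE; simp add: glued_tensor_unit)+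
qed (simp_all add: in_Hom_iff strictification_ident_iso del: tensor_list.simps)

definition realization :: "('o list, 'o list \<times> 'a \<times> 'o list, 'o, 'a) monoidal_functor" where
  "realization = \<lparr>FObj = tensor_list, FArr = (\<lambda>f. fst (snd f)), FTensor = glue, FUnit = Ident C \<I>\<rparr>"

lemma realization_weak_equivalence: "monoidal_weak_equivalence strictification C realization"
proof (intro monoidal_weak_equivalence.intro monoidal_functor.intro
    monoidal_functor_axioms.intro monoidal_weak_equivalence_axioms.intro)
  show "monoidal_category strictification"
    by (rule strictification_monoidal_category)
  show "monoidal_category C"
    by unfold_locales
next
  fix X Y Z
  assume "X \<in> Obj strictification" "Y \<in> Obj strictification" "Z \<in> Obj strictification"
  then show "FArr realization (\<a>\<^bsub>strictification\<^esub> X Y Z) \<cdot> FTensor realization (X \<otimes>\<^bsub>strictification\<^esub> Y) Z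
      \<cdot> (FTensor realization X Y \<otimes>\<^sub>a Ident C (FObj realization Z))
    = FTensor realization X (Y \<otimes>\<^bsub>strictification\<^esub> Z)
      \<cdot> (Ident C (FObj realization X) \<otimes>\<^sub>a FTensor realization Y Z)
      \<cdot> \<a> (FObj realization X) (FObj realization Y) (FObj realization Z)"
    by (simp add: realization_def glue_assoc)
next
  fix A
  assume A: "A \<in> Obj C"
  then have "\<r> A \<in> Hom C (FObj realization [A]) A" "is_iso C (\<r> A)"
    by (simp_all add: realization_def in_Hom_iff)
  moreover have "[A] \<in> Obj strictification"
    using A by simp
  ultimately show "\<exists>Xs \<in> Obj strictification. FObj realization Xs \<cong> A"
    unfolding isomorphic_def by blast
next
  fix Xs Ys g
  assume "Xs \<in> Obj strictification" "Ys \<in> Obj strictification"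
    "g \<in> Hom C (FObj realization Xs) (FObj realization Ys)"
  then have "(Xs, g, Ys) \<in> Hom strictification Xs Ys"
    by (simp add: realization_def in_Hom_iff)
  moreover have "FArr realization (Xs, g, Ys) = g"
    by (simp add: realization_def)
  ultimately show "\<exists>f \<in> Hom strictification Xs Ys. FArr realization f = g"
    by blast
qed (((elim strictification_HomE)?,
    simp add: realization_def in_Hom_iff glued_tensor_glue glue_Nil_right)+)

end

text \<open>If \<open>Y\<close> inverts the product of \<open>Xs\<close> in \<open>C\<close>, then \<open>[Y]\<close> inverts \<open>Xs\<close>. Since every arrow of the
  strictification is an isomorphism, an arrow to the unit suffices on each side; it is
  composed from the given one, \<open>\<r> Y\<close> (as \<open>[Y]\<close> stands for \<open>Y \<otimes> \<I>\<close>), and the inverse of \<open>glue\<close>.\<close>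

lemma (in gr_category) strictification_strict_gr_category: "strict_gr_category strictification"
proof (intro strict_gr_category.intro gr_category.intro gr_category_axioms.intro
    strict_gr_category_axioms.intro)
  show "monoidal_category strictification"
    by (rule strictification_monoidal_category)
  show iso: "is_iso strictification f" if "f \<in> Arr strictification" for f
  proof (cases f)
    case (fields Xs f' Ys)
    then have "is_iso C f'"
      using that by (intro arr_iso) simp
    then show ?thesis
      using that unfolding fields by (intro strictification_iso)
  qed
  fix Xs
  assume Xs: "Xs \<in> Obj strictification"
  then obtain Y where Y: "Y \<in> Obj C" "tensor_list Xs \<otimes> Y \<cong> \<I>" "Y \<otimes> tensor_list Xs \<cong> \<I>"
    using obj_invertible[of "tensor_list Xs"] tensor_list_obj[of Xs] by force
  then obtain f g where
    f: "f \<in> Arr C" "Dom C f = tensor_list Xs \<otimes> Y" "Cod C f = \<I>" and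
    g: "g \<in> Arr C" "Dom C g = Y \<otimes> tensor_list Xs" "Cod C g = \<I>"
    by (auto simp: isomorphic_def in_Hom_iff)
  let ?f = "(Xs @ [Y], f \<cdot> (Ident C (tensor_list Xs) \<otimes>\<^sub>a \<r> Y) \<cdot> inv (glue Xs [Y]), [])"
  let ?g = "([Y] @ Xs, g \<cdot> (\<r> Y \<otimes>\<^sub>a Ident C (tensor_list Xs)) \<cdot> inv (glue [Y] Xs), [])"
  have "?f \<in> Hom strictification (Xs @ [Y]) []" "?g \<in> Hom strictification ([Y] @ Xs) []"
    using Xs Y(1) f g by (simp_all add: in_Hom_iff del: append_Cons append_Nil glue.simps)
  then have "Xs @ [Y] \<cong>\<^bsub>strictification\<^esub> []" "[Y] @ Xs \<cong>\<^bsub>strictification\<^esub> []"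
    unfolding isomorphic_def by (blast intro: iso dest: in_Hom_iff[THEN iffD1])+
  then show "\<exists>Ys \<in> Obj strictification.
      Xs \<otimes>\<^bsub>strictification\<^esub> Ys \<cong>\<^bsub>strictification\<^esub> \<I>\<^bsub>strictification\<^esub> \<and>
      Ys \<otimes>\<^bsub>strictification\<^esub> Xs \<cong>\<^bsub>strictification\<^esub> \<I>\<^bsub>strictification\<^esub>"
    using Y(1) by (intro bexI[of _ "[Y]"]) simp_all
qed simp_all

theorem theorem9:
  fixes C :: "('o, 'a) monoidal_category"
  assumes "gr_category C"
  shows "\<exists>D :: ('o list, 'o list \<times> 'a \<times> 'o list) monoidal_category.
           strict_gr_category D \<and> gr_equivalent C D"
proof -
  interpret gr_category C by fact
  interpret R: monoidal_weak_equivalence strictification C realization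
    by (rule realization_weak_equivalence)
  have "strict_gr_category strictification"
    by (rule strictification_strict_gr_category)
  moreover have "gr_equivalent C strictification"
    using assms calculation R.monoidally_equivalent
    by (simp add: gr_equivalent_def strict_gr_category_def)
  ultimately show ?thesis
    by blast
qed

end
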